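(* Let $m,n$ be positive integers and $s,k$ even positive integers. There exists an integer ${}^2\mathrm{H}(m,n;s,k)$ if and only if $ms=nk$, $2\le s\le n$, $2\le k\le m$, and (1) if $s=2$, then either $n=2$ and $m=k\equiv 0\pmod 4$, or $n,k\ge 3$; (2) if $k=2$, then either $m=2$ and $n=s\equiv 0\pmod 4$, or $m,s\ge 3$.
   Context: For positive integers $m,n,s,k,\lambda,t$ with $t$ dividing $\frac{2nk}{\lambda}$, let $v=\frac{2nk}{\lambda}+t$ and $J$ the subgroup of $\mathbb{Z}_v$ of order $t$. A ${}^\lambda\mathrm{H}_t(m,n;s,k)$ is an $m\times n$ partially filled array with entries in $\mathbb{Z}_v$ such that: (a) each row has exactly $s$ and each column exactly $k$ filled cells; (b) the multiset $\{\pm x: x$ an entry of a filled cell$\}$ contains each element of $\mathbb{Z}_v\setminus J$ exactly $\lambda$ times and no element of $J$; (c) every row and every column sums to $0$ in $\mathbb{Z}_v$. The subscript $t$ is omitted when $t=1$, so ${}^2\mathrm{H}(m,n;s,k)$ is over $\mathbb{Z}_{nk+1}$. The array is integer if, representing each entry by its integer representative in $\pm\{1,\dots,\lfloor v/2\rfloor\}$, every row and every column sums to $0$ in $\mathbb{Z}$. *)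

theory Defs
  imports Main "HOL-Library.Multiset"
begin

text \<open>A partially filled m x n array: A i j = None means the cell (i,j) is empty,
  A i j = Some x means it is filled with the residue x of Z_v, represented by
  an integer in {0..<v}. Rows are indexed by i < m, columns by j < n.\<close>

type_synonym parray = "nat \<Rightarrow> nat \<Rightarrow> int option"

definition filled_cells :: "nat \<Rightarrow> nat \<Rightarrow> parray \<Rightarrow> (nat \<times> nat) set" where
  "filled_cells m n A = {(i, j). i < m \<and> j < n \<and> A i j \<noteq> None}"

definition row_cells :: "nat \<Rightarrow> parray \<Rightarrow> nat \<Rightarrow> nat set" where
  "row_cells n A i = {j. j < n \<and> A i j \<noteq> None}"

definition col_cells :: "nat \<Rightarrow> parray \<Rightarrow> nat \<Rightarrow> nat set" where
  "col_cells m A j = {i. i < m \<and> A i j \<noteq> None}"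

definition hv :: "nat \<Rightarrow> nat \<Rightarrow> nat \<Rightarrow> nat \<Rightarrow> nat" where
  "hv lam t n k = 2 * n * k div lam + t"

text \<open>The subgroup J of Z_v of order t (t divides v), as a set of residues in {0..<v}.\<close>
definition subgrpJ :: "nat \<Rightarrow> nat \<Rightarrow> int set" where
  "subgrpJ v t = {y. 0 \<le> y \<and> y < int v \<and> int (v div t) dvd y}"

definition pm_multiset :: "nat \<Rightarrow> nat \<Rightarrow> nat \<Rightarrow> parray \<Rightarrow> int multiset" where
  "pm_multiset v m n A =
     (\<Sum>c\<in>filled_cells m n A. {# the (A (fst c) (snd c)) mod int v,
                                 (- the (A (fst c) (snd c))) mod int v #})"

definition heffter :: "nat \<Rightarrow> nat \<Rightarrow> nat \<Rightarrow> nat \<Rightarrow> nat \<Rightarrow> nat \<Rightarrow> parray \<Rightarrow> bool" where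
  "heffter lam t m n s k A \<longleftrightarrow>
     (let v = hv lam t n k in
        lam dvd 2 * n * k \<and> t dvd (2 * n * k div lam)
      \<and> (\<forall>i j. A i j \<noteq> None \<longrightarrow> i < m \<and> j < n)
      \<and> (\<forall>i j x. A i j = Some x \<longrightarrow> 0 \<le> x \<and> x < int v)
      \<and> (\<forall>i<m. card (row_cells n A i) = s)
      \<and> (\<forall>j<n. card (col_cells m A j) = k)
      \<and> (\<forall>y. 0 \<le> y \<and> y < int v \<longrightarrow>
            count (pm_multiset v m n A) y = (if y \<in> subgrpJ v t then 0 else lam))
      \<and> (\<forall>i<m. (\<Sum>j\<in>row_cells n A i. the (A i j)) mod int v = 0)
      \<and> (\<forall>j<n. (\<Sum>i\<in>col_cells m A j. the (A i j)) mod int v = 0))"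

text \<open>Integer representative of a residue in +-{1..floor(v/2)} (for the nonzero residues);
  residue v/2 for even v is represented by +v/2 (irrelevant for odd v).\<close>
definition int_rep :: "nat \<Rightarrow> int \<Rightarrow> int" where
  "int_rep v x = (let r = x mod int v in if r \<le> int v div 2 then r else r - int v)"

definition integer_heffter :: "nat \<Rightarrow> nat \<Rightarrow> nat \<Rightarrow> nat \<Rightarrow> nat \<Rightarrow> nat \<Rightarrow> parray \<Rightarrow> bool" where
  "integer_heffter lam t m n s k A \<longleftrightarrow>
     heffter lam t m n s k A \<and>
     (let v = hv lam t n k in
        (\<forall>i<m. (\<Sum>j\<in>row_cells n A i. int_rep v (the (A i j))) = 0)
      \<and> (\<forall>j<n. (\<Sum>i\<in>col_cells m A j. int_rep v (the (A i j))) = 0))"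

end

theory Submission
  imports Defs "HOL-Library.Disjoint_Sets"
begin

text \<open>Replacing residues by their representatives, one looks for integer arrays with zero row and
  column sums in which every absolute value 1, ..., nk/2 occurs exactly twice. If s = k = 2, every
  absolute value would occur in three cells; if s = n = 2, every row is x, -x and a parity count of
  the first column gives the divisibility by 4.

  For existence, up to transposition k is at least 4, and the array is built with every row made of
  s/2 pairs x, -x. Such an array is a k-regular multigraph on the n columns with a circulation whose
  edge values have the distinct absolute values 1, ..., nk/2, together with a partition of the edges
  into m matchings of size s/2, one for each row. By an exchange argument, any proper edge colouring
  with at most m colours can be made equitable, so it suffices to find a circulation on a graph with
  such a colouring. For even n, the graphs are glued from three small ones on 2, 4 and 6 vertices, by
  disjoint union and superposition; for odd n the graph is a cycle of length n with every edge
  repeated k/2 times.\<close>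

subsection \<open>Equitable edge colourings\<close>

text \<open>\<open>D\<close> stands in for the connected component of \<open>a\<close>. It is a
  largest edge set containing \<open>a\<close> that spans at most \<open>card D + 1\<close>
  vertices: an outside edge touching it would bring at most one new vertex and could be
  added.\<close>

lemma closed_edge_set:
  fixes V :: "'e \<Rightarrow> 'v set"
  assumes fin: "finite X" and a: "a \<in> X" and V: "\<And>e. e \<in> X \<Longrightarrow> card (V e) = 2"
  obtains D where "a \<in> D" "D \<subseteq> X" "\<And>e f. e \<in> D \<Longrightarrow> f \<in> X - D \<Longrightarrow> V e \<inter> V f = {}"
    "card (\<Union>(V ` D)) \<le> card D + 1"
proof -
  define S where "S = {D. a \<in> D \<and> D \<subseteq> X \<and> card (\<Union>(V ` D)) \<le> card D + 1}"
  have finS: "finite S"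
    using fin by (auto simp: S_def intro: finite_subset[of _ "Pow X"])
  moreover have "{a} \<in> S" using a V[OF a] by (simp add: S_def)
  ultimately obtain D where D: "D \<in> S" and max: "\<And>D'. D' \<in> S \<Longrightarrow> card D' \<le> card D"
    using Max_in[of "card ` S"] Max_ge[of "card ` S"] by (metis finite_imageI imageE image_eqI empty_iff)
  have finD: "finite D" using D fin by (auto simp: S_def intro: finite_subset)
  have "V e \<inter> V f = {}" if e: "e \<in> D" and f: "f \<in> X - D" for e f
  proof (rule ccontr)
    assume ne: "V e \<inter> V f \<noteq> {}"
    have finV: "finite (V g)" if "g \<in> X" for g using V[OF that] by (simp add: card_ge_0_finite)
    have finU: "finite (\<Union>(V ` D))" using finD D finV by (auto simp: S_def)
    have eX: "e \<in> X" using e D by (auto simp: S_def)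
    have "card (V f - \<Union>(V ` D)) < card (V f)"
      by (rule psubset_card_mono) (use ne e f finV in auto)
    then have le1: "card (V f - \<Union>(V ` D)) \<le> 1" using V[of f] f by simp
    have "\<Union>(V ` insert f D) = \<Union>(V ` D) \<union> (V f - \<Union>(V ` D))" by auto
    then have "card (\<Union>(V ` insert f D)) \<le> card (\<Union>(V ` D)) + card (V f - \<Union>(V ` D))"
      by (metis card_Un_le)
    then have "card (\<Union>(V ` insert f D)) \<le> card (insert f D) + 1"
      using le1 D f finD by (simp add: S_def)
    then have "insert f D \<in> S" using D f by (auto simp: S_def)
    from max[OF this] show False using finD f by simp
  qed
  with D that show thesis by (auto simp: S_def)
qed

text \<open>Take the set \<open>D\<close> around an edge of \<open>A\<close>. Its
  \<open>A\<close>-edges are disjoint, so twice their number is at most the number of vertices of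
  \<open>D\<close>, hence at most \<open>card D + 1\<close>. So \<open>D\<close> has at most one
  more edge in \<open>A\<close> than in \<open>B\<close>; if exactly one, it is the wanted set,
  otherwise it is discarded.\<close>

lemma balancing_edge_set:
  fixes V :: "'e \<Rightarrow> 'v set"
  assumes "finite X" and "\<And>e. e \<in> X \<Longrightarrow> card (V e) = 2"
    and "disjoint_family_on V (X \<inter> A)" and "card (X \<inter> B) < card (X \<inter> A)"
    and "X \<subseteq> A \<union> B" "A \<inter> B = {}"
  shows "\<exists>C\<subseteq>X. card (C \<inter> A) = card (C \<inter> B) + 1
      \<and> (\<forall>e\<in>C. \<forall>f\<in>X - C. V e \<inter> V f = {})"
  using assms
proof (induction "card X" arbitrary: X rule: less_induct)
  case less
  have "X \<inter> A \<noteq> {}" using less.prems(4) by force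
  then obtain a where a: "a \<in> X \<inter> A" by blast
  obtain D where D: "a \<in> D" "D \<subseteq> X" "\<And>e f. e \<in> D \<Longrightarrow> f \<in> X - D \<Longrightarrow> V e \<inter> V f = {}"
    "card (\<Union>(V ` D)) \<le> card D + 1"
    using closed_edge_set[of X a V] less.prems(1,2) a by blast
  have finD: "finite D" using D(2) less.prems(1) by (rule finite_subset)
  have finV: "finite (V g)" if "g \<in> X" for g using less.prems(2)[OF that] by (simp add: card_ge_0_finite)
  have "card (\<Union>(V ` (D \<inter> A))) = (\<Sum>e\<in>D \<inter> A. card (V e))"
    using less.prems(3) D(2) finD finV
    by (intro card_UN_disjoint) (auto simp: disjoint_family_on_def)
  also have "\<dots> = (\<Sum>e\<in>D \<inter> A. 2)"
    by (rule sum.cong) (use less.prems(2) D(2) in auto)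
  finally have "2 * card (D \<inter> A) = card (\<Union>(V ` (D \<inter> A)))" by simp
  also have "\<dots> \<le> card (\<Union>(V ` D))"
    by (rule card_mono) (use finD finV D(2) in auto)
  also have "\<dots> \<le> card D + 1" by (rule D(4))
  also have "card D = card (D \<inter> A) + card (D \<inter> B)"
  proof -
    have "D = (D \<inter> A) \<union> (D \<inter> B)" using D(2) less.prems(5) by blast
    then show ?thesis using card_Un_disjoint[of "D \<inter> A" "D \<inter> B"] finD less.prems(6) by auto
  qed
  finally have le: "card (D \<inter> A) \<le> card (D \<inter> B) + 1" by simp
  show ?case
  proof (cases "card (D \<inter> A) = card (D \<inter> B) + 1")
    case True
    then show ?thesis using D by blast
  next
    case False
    \<comment> \<open>Here \<open>D\<close> has no surplus of \<open>A\<close>-edges, so the surplus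
      of \<open>A\<close> over \<open>B\<close> survives in \<open>X - D\<close> and induction
      applies.\<close>
    let ?X = "X - D"
    have cX: "card (X \<inter> Y) = card (D \<inter> Y) + card (?X \<inter> Y)" for Y
    proof -
      have "X \<inter> Y = (D \<inter> Y) \<union> (?X \<inter> Y)" using D(2) by blast
      then show ?thesis using card_Un_disjoint[of "D \<inter> Y" "?X \<inter> Y"] finD less.prems(1) by auto
    qed
    have "card (?X \<inter> B) < card (?X \<inter> A)"
      using cX[of A] cX[of B] less.prems(4) False le by linarith
    moreover have "card ?X < card X"
      using D(1,2) less.prems(1) by (intro psubset_card_mono) auto
    moreover have "disjoint_family_on V (?X \<inter> A)"
      using less.prems(3) by (auto simp: disjoint_family_on_def)
    moreover have "?X \<subseteq> A \<union> B" using less.prems(5) by blast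
    ultimately obtain C where C: "C \<subseteq> ?X" "card (C \<inter> A) = card (C \<inter> B) + 1"
        "\<forall>e\<in>C. \<forall>f\<in>?X - C. V e \<inter> V f = {}"
      using less.hyps[of ?X] less.prems by auto
    have "V e \<inter> V f = {}" if "e \<in> C" "f \<in> X - C" for e f
      using that C D(3)[of f e] by (cases "f \<in> D") auto
    then show ?thesis using C by blast
  qed
qed

text \<open>The two matchings are exchanged on the set \<open>C\<close> from
  \<open>balancing_edge_set\<close>. No edge of \<open>C\<close> meets an edge outside it, so both
  results are matchings, and the surplus of one in \<open>C\<close> shifts each size by one.\<close>

lemma balance_two_matchings:
  fixes V :: "'e \<Rightarrow> 'v set"
  assumes fin: "finite A" "finite B" and V: "\<And>e. e \<in> A \<union> B \<Longrightarrow> card (V e) = 2"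
    and A: "disjoint_family_on V A" and B: "disjoint_family_on V B"
    and "A \<inter> B = {}" and "card B < card A"
  obtains A' B' where "A' \<inter> B' = {}" "A' \<union> B' = A \<union> B" "disjoint_family_on V A'"
    "disjoint_family_on V B'" "card A' + 1 = card A" "card B' = card B + 1"
proof -
  have int: "(A \<union> B) \<inter> A = A" "(A \<union> B) \<inter> B = B" by auto
  obtain C where C: "C \<subseteq> A \<union> B" "card (C \<inter> A) = card (C \<inter> B) + 1"
      "\<forall>e\<in>C. \<forall>f\<in>(A \<union> B) - C. V e \<inter> V f = {}"
    using balancing_edge_set[of "A \<union> B" V A B] assms by (auto simp: int)
  let ?A = "(A - C) \<union> (B \<inter> C)" and ?B = "(B - C) \<union> (A \<inter> C)"
  have dj: "disjoint_family_on V ((P - C) \<union> (Q \<inter> C))"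
    if "disjoint_family_on V P" "disjoint_family_on V Q" "P \<subseteq> A \<union> B" "Q \<subseteq> A \<union> B" for P Q
    unfolding disjoint_family_on_def
  proof (intro ballI impI)
    fix e f assume ef: "e \<in> (P - C) \<union> (Q \<inter> C)" "f \<in> (P - C) \<union> (Q \<inter> C)" "e \<noteq> f"
    show "V e \<inter> V f = {}"
    proof (cases "e \<in> C \<longleftrightarrow> f \<in> C")
      case True
      then have "e \<in> P \<and> f \<in> P \<or> e \<in> Q \<and> f \<in> Q" using ef by auto
      then show ?thesis using ef(3) that(1,2) unfolding disjoint_family_on_def by blast
    next
      case False
      then have "e \<in> C \<and> f \<in> (A \<union> B) - C \<or> f \<in> C \<and> e \<in> (A \<union> B) - C"
        using ef that(3,4) by auto
      then show ?thesis using C(3) by (metis Int_commute)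
    qed
  qed
  have cd: "card ((P - C) \<union> (Q \<inter> C)) + card (C \<inter> P) = card P + card (C \<inter> Q)"
    if "finite P" "finite Q" "P \<inter> Q = {}" for P Q
  proof -
    have "card ((P - C) \<union> (Q \<inter> C)) = card (P - C) + card (Q \<inter> C)"
      using that by (intro card_Un_disjoint) auto
    moreover have "card P = card (P - C) + card (P \<inter> C)"
      using card_Int_Diff[OF that(1), of C] by simp
    ultimately show ?thesis by (simp add: Int_commute)
  qed
  show thesis
  proof (rule that[of ?A ?B])
    show "?A \<inter> ?B = {}" using \<open>A \<inter> B = {}\<close> by blast
    show "?A \<union> ?B = A \<union> B" by blast
    show "disjoint_family_on V ?A" "disjoint_family_on V ?B" using dj A B by auto
    show "card ?A + 1 = card A" using cd[of A B] fin assms(6) C(2) by simp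
    have "B \<inter> A = {}" using assms(6) by blast
    then show "card ?B = card B + 1" using cd[of B A] fin C(2) by simp
  qed
qed

text \<open>Edges are labels with an endpoint set \<open>V e\<close>, not vertex pairs, so that
  parallel edges remain distinct; they must then receive different colours.\<close>

definition proper_col :: "('e \<Rightarrow> 'v set) \<Rightarrow> 'e set \<Rightarrow> nat \<Rightarrow> ('e \<Rightarrow> nat) \<Rightarrow> bool" where
  "proper_col V E m c \<longleftrightarrow> (\<forall>e\<in>E. c e < m)
     \<and> (\<forall>e\<in>E. \<forall>f\<in>E. e \<noteq> f \<longrightarrow> c e = c f \<longrightarrow> V e \<inter> V f = {})"

text \<open>Exchanging two colours along an alternating path moves one edge from a large to a small
  colour class.\<close>

lemma equitable_col:
  fixes V :: "'e \<Rightarrow> 'v set"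
  assumes fin: "finite E" and V: "\<And>e. e \<in> E \<Longrightarrow> card (V e) = 2"
    and card: "card E = m * q" and "proper_col V E m c"
  shows "\<exists>c'. proper_col V E m c' \<and> (\<forall>i<m. card {e\<in>E. c' e = i} = q)"
  using assms(4)
\<comment> \<open>The measure is the total deviation of the colour class sizes from
  \<open>q\<close>.\<close>
proof (induction "\<Sum>i<m. nat \<bar>int (card {e\<in>E. c e = i}) - int q\<bar>" arbitrary: c rule: less_induct)
  case less
  define sz where "sz = (\<lambda>c i. card {e\<in>E. c e = (i::nat)})"
  have tot: "(\<Sum>i<m. sz c i) = m * q"
  proof -
    have "(\<Sum>i<m. sz c i) = card (\<Union>i<m. {e\<in>E. c e = i})"
      unfolding sz_def using fin by (intro card_UN_disjoint[symmetric]) auto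
    also have "(\<Union>i<m. {e\<in>E. c e = i}) = E" using less.prems by (auto simp: proper_col_def)
    finally show ?thesis using card by simp
  qed
  show ?case
  proof (cases "\<forall>i<m. sz c i = q")
    case True
    then show ?thesis using less.prems by (auto simp: sz_def)
  next
    case False
    \<comment> \<open>The class sizes have average \<open>q\<close>, so if they are not all equal to
      \<open>q\<close>, one lies above and one below.\<close>
    have ex1: "\<exists>i<m. q < sz c i"
    proof (rule ccontr)
      assume "\<not> ?thesis"
      then have le: "\<forall>i\<in>{..<m}. sz c i \<le> q" by auto
      have "(\<Sum>i<m. sz c i) < (\<Sum>i<m. q)"
        by (rule sum_strict_mono_ex1) (use le False in \<open>auto simp: less_le\<close>)
      then show False using tot by simp
    qed
    have ex2: "\<exists>i<m. sz c i < q"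
    proof (rule ccontr)
      assume "\<not> ?thesis"
      then have le: "\<forall>i\<in>{..<m}. q \<le> sz c i" by auto
      have "(\<Sum>i<m. q) < (\<Sum>i<m. sz c i)"
        by (rule sum_strict_mono_ex1) (use le False in \<open>auto simp: less_le\<close>)
      then show False using tot by simp
    qed
    from ex1 ex2 obtain i j where ij: "i < m" "q < sz c i" "j < m" "sz c j < q" by blast
    let ?A = "{e\<in>E. c e = i}" and ?B = "{e\<in>E. c e = j}"
    have finAB: "finite ?A" "finite ?B" using fin by auto
    have dj: "disjoint_family_on V ?A" "disjoint_family_on V ?B"
      using less.prems by (auto simp: proper_col_def disjoint_family_on_def)
    have lt: "?A \<inter> ?B = {}" "card ?B < card ?A" using ij by (auto simp: sz_def)
    have two: "card (V e) = 2" if "e \<in> ?A \<union> ?B" for e using V that by auto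
    obtain A' B' where AB: "A' \<inter> B' = {}" "A' \<union> B' = ?A \<union> ?B"
      "disjoint_family_on V A'" "disjoint_family_on V B'"
      "card A' + 1 = card ?A" "card B' = card ?B + 1"
      by (rule balance_two_matchings[OF finAB two dj lt])
    define c' where "c' = (\<lambda>e. if e \<in> A' then i else if e \<in> B' then j else c e)"
    have AE: "A' \<subseteq> E" "B' \<subseteq> E" using AB(2) by auto
    have inej: "i \<noteq> j" using ij by auto
    have cl: "{e\<in>E. c' e = l} = (if l = i then A' else if l = j then B' else {e\<in>E. c e = l})" for l
      using AB(1,2) AE inej unfolding c'_def by (auto split: if_splits)
    have "proper_col V E m c'"
      unfolding proper_col_def
    proof (intro conjI ballI impI)
      fix e assume "e \<in> E"
      then show "c' e < m" using less.prems ij by (auto simp: c'_def proper_col_def)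
    next
      fix e f assume ef: "e \<in> E" "f \<in> E" "e \<noteq> f" "c' e = c' f"
      let ?S = "{g\<in>E. c' g = c' e}"
      have "disjoint_family_on V ?S"
        using AB(3,4) less.prems unfolding cl by (auto simp: proper_col_def disjoint_family_on_def)
      moreover have "e \<in> ?S" "f \<in> ?S" using ef by auto
      ultimately show "V e \<inter> V f = {}" using ef(3) unfolding disjoint_family_on_def by blast
    qed
    moreover have "(\<Sum>l<m. nat \<bar>int (sz c' l) - int q\<bar>) < (\<Sum>l<m. nat \<bar>int (sz c l) - int q\<bar>)"
    proof (rule sum_strict_mono_ex1)
      have si: "sz c' i + 1 = sz c i" using AB(5) by (simp add: sz_def cl)
      have sj: "sz c' j = sz c j + 1" using AB(6) inej by (simp add: sz_def cl)
      show "\<forall>l\<in>{..<m}. nat \<bar>int (sz c' l) - int q\<bar> \<le> nat \<bar>int (sz c l) - int q\<bar>"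
      proof
        fix l
        have "sz c' l = sz c l" if "l \<noteq> i" "l \<noteq> j" using that by (simp add: sz_def cl)
        then show "nat \<bar>int (sz c' l) - int q\<bar> \<le> nat \<bar>int (sz c l) - int q\<bar>"
          using si sj ij by (cases "l = i"; cases "l = j") auto
      qed
      show "\<exists>l\<in>{..<m}. nat \<bar>int (sz c' l) - int q\<bar> < nat \<bar>int (sz c l) - int q\<bar>"
        using si ij by (intro bexI[of _ i]) auto
    qed simp
    ultimately show ?thesis using less.hyps unfolding sz_def by blast
  qed
qed

subsection \<open>Integer arrays and circulations\<close>

text \<open>An empty cell is encoded by the value 0.\<close>

definition int_array :: "nat \<Rightarrow> nat \<Rightarrow> nat \<Rightarrow> nat \<Rightarrow> (nat \<Rightarrow> nat \<Rightarrow> int) \<Rightarrow> bool" where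
  "int_array m n s k B \<longleftrightarrow>
     (\<forall>i<m. card {j. j < n \<and> B i j \<noteq> 0} = s)
   \<and> (\<forall>j<n. card {i. i < m \<and> B i j \<noteq> 0} = k)
   \<and> (\<forall>i<m. (\<Sum>j<n. B i j) = 0)
   \<and> (\<forall>j<n. (\<Sum>i<m. B i j) = 0)
   \<and> (\<forall>i<m. \<forall>j<n. \<bar>B i j\<bar> \<le> int (n * k div 2))
   \<and> (\<forall>x\<in>{1..int (n * k div 2)}. card {(i, j). i < m \<and> j < n \<and> \<bar>B i j\<bar> = x} = 2)"

lemma filled_card:
  fixes B :: "nat \<Rightarrow> nat \<Rightarrow> int"
  assumes "\<forall>i<m. card {j. j < n \<and> B i j \<noteq> 0} = s" "\<forall>j<n. card {i. i < m \<and> B i j \<noteq> 0} = k"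
  shows "m * s = n * k"
proof -
  have "m * s = (\<Sum>i<m. \<Sum>j<n. of_bool (B i j \<noteq> 0))"
    using assms(1) by (simp add: Int_def)
  also have "\<dots> = (\<Sum>j<n. \<Sum>i<m. of_bool (B i j \<noteq> 0))" by (rule sum.swap)
  also have "\<dots> = n * k" using assms(2) by (simp add: Int_def)
  finally show ?thesis .
qed

lemma int_array_transpose:
  assumes "int_array m n s k B"
  shows "int_array n m k s (\<lambda>i j. B j i)"
proof -
  \<comment> \<open>The largest absolute value is written as \<open>n * k div 2\<close>; this
    equation makes it symmetric under transposition.\<close>
  have ms: "m * s = n * k" using assms by (intro filled_card[of m n B]) (auto simp: int_array_def)
  have "card {(i, j). i < n \<and> j < m \<and> \<bar>B j i\<bar> = x} = card {(i, j). i < m \<and> j < n \<and> \<bar>B i j\<bar> = x}" for x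
  proof -
    have "{(i, j). i < n \<and> j < m \<and> \<bar>B j i\<bar> = x} = prod.swap ` {(i, j). i < m \<and> j < n \<and> \<bar>B i j\<bar> = x}"
      by (auto simp: image_iff)
    then show ?thesis by (simp add: card_image)
  qed
  then show ?thesis using assms ms by (auto simp: int_array_def)
qed

text \<open>Vertices become columns and the classes of an equitable recolouring become rows. An edge
  puts its weight in the column of its source and the negated weight in that of its target. Rows
  then sum to zero by themselves, columns by flow conservation, and each absolute value fills
  exactly two cells.\<close>

lemma int_array_of_graph:
  fixes src tgt col :: "nat \<Rightarrow> nat" and w :: "nat \<Rightarrow> int"
  defines "V \<equiv> \<lambda>e. {src e, tgt e}"
  assumes N: "N = m * q" "2 * N = n * k"
    and ends: "\<And>e. e < N \<Longrightarrow> src e < n \<and> tgt e < n \<and> src e \<noteq> tgt e"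
    and col0: "proper_col V {..<N} m col"
    and deg: "\<And>v. v < n \<Longrightarrow> card {e. e < N \<and> v \<in> V e} = k"
    and flow: "\<And>v. v < n \<Longrightarrow>
      (\<Sum>e<N. w e * of_bool (src e = v)) = (\<Sum>e<N. w e * of_bool (tgt e = v))"
    and w: "bij_betw (\<lambda>e. \<bar>w e\<bar>) {..<N} {1..int N}"
  shows "\<exists>B. int_array m n (2 * q) k B"
proof -
  have cV: "card (V e) = 2" if "e < N" for e using ends[OF that] by (simp add: V_def)
  obtain c where c: "proper_col V {..<N} m c" and sz: "\<And>i. i < m \<Longrightarrow> card {e\<in>{..<N}. c e = i} = q"
    using equitable_col[of "{..<N}" V m q col] cV N(1) col0 by auto
  have cm: "c e < m" if "e < N" for e using c that by (simp add: proper_col_def)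
  have uniq: "e = f" if "e < N" "f < N" "c e = c f" "v \<in> V e" "v \<in> V f" for e f v
    using c that unfolding proper_col_def by blast
  have wpos: "1 \<le> \<bar>w e\<bar> \<and> \<bar>w e\<bar> \<le> int N" if "e < N" for e
    using bij_betwE[OF w] that by auto
  define sg where "sg = (\<lambda>e v. (of_bool (src e = v) - of_bool (tgt e = v) :: int))"
  have sg0: "sg e v = 0" if "v \<notin> V e" for e v using that by (auto simp: sg_def V_def)
  have sg1: "\<bar>sg e v\<bar> = 1" if "v \<in> V e" "e < N" for e v
    using that ends[of e] by (auto simp: sg_def V_def)
  \<comment> \<open>Edges of one colour are disjoint, so at most one summand is nonzero and distinct
    edges never compete for a cell.\<close>
  define B where "B = (\<lambda>i v. \<Sum>e<N. of_bool (c e = i) * (w e * sg e v))"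
  have Bc: "B (c e) v = w e * sg e v" if "e < N" "v \<in> V e" for e v
  proof -
    have "B (c e) v = (\<Sum>f<N. if f = e then w e * sg e v else 0)"
      unfolding B_def
    proof (rule sum.cong)
      fix f assume "f \<in> {..<N}"
      then show "of_bool (c f = c e) * (w f * sg f v) = (if f = e then w e * sg e v else 0)"
        using uniq[of f e v] that sg0[of v f] by auto
    qed simp
    then show ?thesis using that by simp
  qed
  have Babs: "\<bar>B (c e) v\<bar> = \<bar>w e\<bar>" if "e < N" "v \<in> V e" for e v
    using Bc[OF that] sg1[OF that(2,1)] by (simp add: abs_mult)
  have Bex: "\<exists>e<N. c e = i \<and> v \<in> V e" if "B i v \<noteq> 0" for i v
  proof (rule ccontr)
    assume "\<not> ?thesis"
    then have "B i v = 0" using sg0[of v] unfolding B_def by (intro sum.neutral) auto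
    with that show False by simp
  qed
  have Bnz: "B i v \<noteq> 0 \<longleftrightarrow> (\<exists>e<N. c e = i \<and> v \<in> V e)" for i v
  proof
    assume "\<exists>e<N. c e = i \<and> v \<in> V e"
    then obtain e where "e < N" "c e = i" "v \<in> V e" by blast
    then show "B i v \<noteq> 0" using Babs[of e v] wpos[of e] by auto
  qed (rule Bex)
  have Vn: "v < n" if "e < N" "v \<in> V e" for e v using ends[of e] that by (auto simp: V_def)
  have N2: "n * k div 2 = N" using N(2) by simp
  have "int_array m n (2 * q) k B"
    unfolding int_array_def N2
  proof (intro conjI allI impI ballI)
    fix i assume i: "i < m"
    have "{j. j < n \<and> B i j \<noteq> 0} = (\<Union>e\<in>{e\<in>{..<N}. c e = i}. V e)"
      unfolding Bnz using Vn by auto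
    also have "card \<dots> = (\<Sum>e\<in>{e\<in>{..<N}. c e = i}. card (V e))"
      using uniq by (intro card_UN_disjoint) (auto simp: V_def)
    also have "\<dots> = (\<Sum>e\<in>{e\<in>{..<N}. c e = i}. 2)" by (rule sum.cong) (use cV in auto)
    also have "\<dots> = 2 * q" using sz[OF i] by simp
    finally show "card {j. j < n \<and> B i j \<noteq> 0} = 2 * q" .
  next
    fix v assume v: "v < n"
    \<comment> \<open>Edges at a common vertex have different colours, so the filled cells of a
      column correspond to the edges at that vertex.\<close>
    have "{i. i < m \<and> B i v \<noteq> 0} = c ` {e. e < N \<and> v \<in> V e}"
      unfolding Bnz using cm by auto
    moreover have "inj_on c {e. e < N \<and> v \<in> V e}"
      using uniq by (auto intro!: inj_onI)
    ultimately show "card {i. i < m \<and> B i v \<noteq> 0} = k" using deg[OF v] by (simp add: card_image)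
  next
    fix i assume i: "i < m"
    have "(\<Sum>j<n. sg e j) = 0" if "e < N" for e
      using ends[OF that] by (simp add: sg_def sum_subtractf of_bool_def)
    then have "(\<Sum>e<N. of_bool (c e = i) * (w e * (\<Sum>j<n. sg e j))) = 0" by simp
    moreover have "(\<Sum>j<n. B i j) = (\<Sum>e<N. of_bool (c e = i) * (w e * (\<Sum>j<n. sg e j)))"
      unfolding B_def by (subst sum.swap) (simp add: sum_distrib_left)
    ultimately show "(\<Sum>j<n. B i j) = 0" by simp
  next
    fix v assume v: "v < n"
    have "(\<Sum>i<m. B i v) = (\<Sum>e<N. \<Sum>i<m. of_bool (c e = i) * (w e * sg e v))"
      unfolding B_def by (rule sum.swap)
    also have "\<dots> = (\<Sum>e<N. w e * sg e v)"
    proof (rule sum.cong)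
      fix e assume "e \<in> {..<N}"
      then show "(\<Sum>i<m. of_bool (c e = i) * (w e * sg e v)) = w e * sg e v"
        using cm[of e] by (simp add: of_bool_def if_distrib[of "\<lambda>x. x * _"] cong: if_cong)
    qed simp
    also have "\<dots> = 0" using flow[OF v] by (simp add: sg_def right_diff_distrib sum_subtractf)
    finally show "(\<Sum>i<m. B i v) = 0" .
  next
    fix i v assume "i < m" "v < n"
    show "\<bar>B i v\<bar> \<le> int N"
    proof (cases "B i v = 0")
      case False
      then obtain e where "e < N" "c e = i" "v \<in> V e" using Bex by blast
      then show ?thesis using Babs[of e v] wpos[of e] by auto
    qed simp
  next
    fix x assume x: "x \<in> {1..int N}"
    then have "x \<in> (\<lambda>e. \<bar>w e\<bar>) ` {..<N}" using w by (simp add: bij_betw_def)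
    then obtain e where e: "e < N" "\<bar>w e\<bar> = x" by blast
    have "{(i, j). i < m \<and> j < n \<and> \<bar>B i j\<bar> = x} = {(c e, src e), (c e, tgt e)}" (is "?L = ?R")
    proof
      show "?R \<subseteq> ?L" using e cm ends Babs by (auto simp: V_def)
      show "?L \<subseteq> ?R"
      proof
        fix z assume "z \<in> ?L"
        then obtain i j where ij: "z = (i, j)" "\<bar>B i j\<bar> = x" by blast
        then have "B i j \<noteq> 0" using x by auto
        then obtain f where f: "f < N" "c f = i" "j \<in> V f" using Bex by blast
        then have "\<bar>w f\<bar> = \<bar>w e\<bar>" using Babs[of f j] ij e by simp
        then have "f = e" using w e(1) f(1) by (auto simp: bij_betw_def inj_on_def)
        then show "z \<in> ?R" using f ij(1) by (auto simp: V_def)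
      qed
    qed
    then show "card {(i, j). i < m \<and> j < n \<and> \<bar>B i j\<bar> = x} = 2" using ends[OF e(1)] by simp
  qed
  then show ?thesis by blast
qed

subsection \<open>Integer representatives\<close>

lemma hv_2_1: "even k \<Longrightarrow> hv 2 1 n k = 2 * (n * k div 2) + 1"
  by (simp add: hv_def)

lemma int_rep_odd:
  assumes "v = 2 * N + 1"
  shows "int_rep v x = (if x mod int v \<le> int N then x mod int v else x mod int v - int v)"
  using assms by (simp add: int_rep_def)

lemma int_rep_mod_id:
  assumes "v = 2 * N + 1" "\<bar>b\<bar> \<le> int N"
  shows "int_rep v (b mod int v) = b"
proof (cases "b \<ge> 0")
  case True
  then show ?thesis using assms by (simp add: int_rep_odd)
next
  case False
  then have "b mod int v = (b + int v) mod int v" by simp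
  also have "\<dots> = b + int v" using False assms by (intro mod_pos_pos_trivial) auto
  finally show ?thesis using assms False by (simp add: int_rep_odd)
qed

lemma int_rep_bounds:
  assumes "v = 2 * N + 1"
  shows "\<bar>int_rep v x\<bar> \<le> int N"
proof -
  define r where "r = x mod int v"
  have "0 \<le> r" "r < int v" "int v = 2 * int N + 1" using assms by (simp_all add: r_def)
  then show ?thesis unfolding int_rep_odd[OF assms] r_def[symmetric] by auto
qed

lemma int_rep_cong: "int_rep v x mod int v = x mod int v"
  by (simp add: int_rep_def Let_def)

text \<open>As \<open>v\<close> is odd, a nonzero residue differs from its negative, so at most one
  of \<open>x\<close> and \<open>-x\<close> equals \<open>y\<close>; one does exactly when the
  representatives agree up to sign. This turns multiplicities in \<open>pm_multiset\<close> into
  counts of absolute values.\<close>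

lemma int_rep_pm:
  assumes v: "v = 2 * N + 1" and y: "1 \<le> y" "y < int v"
  shows "(of_bool (x mod int v = y) + of_bool (- x mod int v = y) :: nat)
    = of_bool (\<bar>int_rep v x\<bar> = \<bar>int_rep v y\<bar>)"
proof -
  define r V where "r = x mod int v" and "V = int v"
  have V: "V = 2 * int N + 1" and r: "0 \<le> r" "r < V" and y: "1 \<le> y" "y < V"
    using v y by (auto simp: r_def V_def)
  have "int_rep v x = (if r \<le> int N then r else r - V)"
    by (simp add: int_rep_odd[OF v] r_def V_def)
  moreover have "int_rep v y = (if y \<le> int N then y else y - V)"
    using y by (simp add: int_rep_odd[OF v] V_def)
  moreover have "- x mod int v = (if r = 0 then 0 else V - r)"
    unfolding r_def V_def by (rule zmod_zminus1_eq_if)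
  ultimately show ?thesis
    unfolding r_def[symmetric] using V r y by (auto simp: of_bool_def abs_if split: if_splits)
qed

lemma finite_filled_cells: "finite (filled_cells m n A)"
  by (rule finite_subset[of _ "{..<m} \<times> {..<n}"]) (auto simp: filled_cells_def)

lemma count_pm_multiset:
  "count (pm_multiset v m n A) y = (\<Sum>c\<in>filled_cells m n A.
     of_bool (the (A (fst c) (snd c)) mod int v = y) + of_bool (- the (A (fst c) (snd c)) mod int v = y))"
  unfolding pm_multiset_def count_sum by (rule sum.cong) auto

text \<open>Here \<open>B\<close> holds the representatives of the entries of \<open>A\<close>, with
  0 for empty cells, and the two lists of conditions are matched one by one.\<close>

lemma integer_heffter_iff_int_array:
  assumes k: "even k" and v: "v = 2 * (n * k div 2) + 1"
    and out: "\<And>i j. A i j \<noteq> None \<Longrightarrow> i < m \<and> j < n"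
    and range: "\<And>i j x. A i j = Some x \<Longrightarrow> 0 \<le> x \<and> x < int v"
    and nz: "\<And>i j. i < m \<Longrightarrow> j < n \<Longrightarrow> A i j \<noteq> None \<longleftrightarrow> B i j \<noteq> 0"
    and B: "\<And>i j x. A i j = Some x \<Longrightarrow> B i j = int_rep v x"
  shows "integer_heffter 2 1 m n s k A \<longleftrightarrow> int_array m n s k B"
proof -
  let ?N = "n * k div 2"
  have hv: "hv 2 1 n k = v" using hv_2_1[OF k] v by simp
  \<comment> \<open>For \<open>t = 1\<close> the subgroup consists of 0 alone.\<close>
  have J: "y \<in> subgrpJ v 1 \<longleftrightarrow> y = 0" if "0 \<le> y" "y < int v" for y
    using that zdvd_not_zless[of y "int v"] by (cases "y = 0") (auto simp: subgrpJ_def)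
  have the: "B i j = int_rep v (the (A i j))" if "A i j \<noteq> None" for i j
    using that B by auto
  have rc: "row_cells n A i = {j. j < n \<and> B i j \<noteq> 0}" if "i < m" for i
    using nz that by (auto simp: row_cells_def)
  have cc: "col_cells m A j = {i. i < m \<and> B i j \<noteq> 0}" if "j < n" for j
    using nz that by (auto simp: col_cells_def)
  have rs: "(\<Sum>j\<in>row_cells n A i. int_rep v (the (A i j))) = (\<Sum>j<n. B i j)" if "i < m" for i
  proof -
    have "(\<Sum>j\<in>row_cells n A i. int_rep v (the (A i j))) = (\<Sum>j\<in>row_cells n A i. B i j)"
      by (rule sum.cong) (auto simp: row_cells_def B)
    also have "\<dots> = (\<Sum>j<n. B i j)"
      unfolding rc[OF that] by (rule sum.mono_neutral_left) auto
    finally show ?thesis .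
  qed
  have cs: "(\<Sum>i\<in>col_cells m A j. int_rep v (the (A i j))) = (\<Sum>i<m. B i j)" if "j < n" for j
  proof -
    have "(\<Sum>i\<in>col_cells m A j. int_rep v (the (A i j))) = (\<Sum>i\<in>col_cells m A j. B i j)"
      by (rule sum.cong) (auto simp: col_cells_def B)
    also have "\<dots> = (\<Sum>i<m. B i j)"
      unfolding cc[OF that] by (rule sum.mono_neutral_left) auto
    finally show ?thesis .
  qed
  \<comment> \<open>Sums of entries and of representatives agree modulo \<open>v\<close>, so the
    modular row and column conditions follow from the integer ones.\<close>
  have modsum: "(\<Sum>x\<in>X. f x) mod int v = (\<Sum>x\<in>X. int_rep v (f x)) mod int v" for X and f :: "nat \<Rightarrow> int"
  proof -
    have "(\<Sum>x\<in>X. f x) mod int v = (\<Sum>x\<in>X. f x mod int v) mod int v" by (rule mod_sum_eq[symmetric])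
    also have "\<dots> = (\<Sum>x\<in>X. int_rep v (f x) mod int v) mod int v" by (simp only: int_rep_cong)
    also have "\<dots> = (\<Sum>x\<in>X. int_rep v (f x)) mod int v" by (rule mod_sum_eq)
    finally show ?thesis .
  qed
  have cnt0: "count (pm_multiset v m n A) 0 = 0"
    unfolding count_pm_multiset
  proof (intro sum.neutral ballI)
    fix c assume "c \<in> filled_cells m n A"
    then obtain i j x where c: "c = (i, j)" "A i j = Some x" "i < m" "j < n"
      by (auto simp: filled_cells_def)
    then have "int_rep v x \<noteq> 0" using nz[of i j] B by auto
    then have "x mod int v \<noteq> 0" by (auto simp: int_rep_def)
    moreover have "- x mod int v \<noteq> 0" using calculation pos_mod_bound[of "int v" x] v
      by (auto simp: zmod_zminus1_eq_if simp del: pos_mod_bound)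
    ultimately show "of_bool (the (A (fst c) (snd c)) mod int v = 0) +
         of_bool (- the (A (fst c) (snd c)) mod int v = 0) = (0::nat)" using c by simp
  qed
  have cnt: "count (pm_multiset v m n A) y = card {(i, j). i < m \<and> j < n \<and> \<bar>B i j\<bar> = \<bar>int_rep v y\<bar>}"
    if y: "1 \<le> y" "y < int v" for y
  proof -
    have y0: "int_rep v y \<noteq> 0" using y by (simp add: int_rep_def)
    have "count (pm_multiset v m n A) y
        = (\<Sum>c\<in>filled_cells m n A. of_bool (\<bar>B (fst c) (snd c)\<bar> = \<bar>int_rep v y\<bar>))"
      unfolding count_pm_multiset int_rep_pm[OF v y]
      by (rule sum.cong) (auto simp: filled_cells_def B)
    also have "\<dots> = card (filled_cells m n A \<inter> {c. \<bar>B (fst c) (snd c)\<bar> = \<bar>int_rep v y\<bar>})"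
      using finite_filled_cells by simp
    also have "filled_cells m n A \<inter> {c. \<bar>B (fst c) (snd c)\<bar> = \<bar>int_rep v y\<bar>}
        = {(i, j). i < m \<and> j < n \<and> \<bar>B i j\<bar> = \<bar>int_rep v y\<bar>}"
      using y0 nz by (fastforce simp: filled_cells_def)
    finally show ?thesis .
  qed
  \<comment> \<open>Each \<open>x\<close> from 1 to \<open>?N\<close> represents itself, and every
    nonzero residue has a representative with absolute value in that range, so both sides prescribe
    the same counts.\<close>
  have cnt_iff: "(\<forall>y. 0 \<le> y \<and> y < int v \<longrightarrow>
            count (pm_multiset v m n A) y = (if y \<in> subgrpJ v 1 then 0 else 2))
      \<longleftrightarrow> (\<forall>x\<in>{1..int ?N}. card {(i, j). i < m \<and> j < n \<and> \<bar>B i j\<bar> = x} = 2)" (is "?L \<longleftrightarrow> ?R")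
  proof
    assume L: ?L
    show ?R
    proof
      fix x assume x: "x \<in> {1..int ?N}"
      then have "x mod int v = x" using v by (intro mod_pos_pos_trivial) auto
      then have "int_rep v x = x" using int_rep_mod_id[OF v, of x] x by simp
      then show "card {(i, j). i < m \<and> j < n \<and> \<bar>B i j\<bar> = x} = 2"
        using L[rule_format, of x] cnt[of x] J[of x] x v by simp
    qed
  next
    assume R: ?R
    show ?L
    proof (intro allI impI)
      fix y assume y: "0 \<le> y \<and> y < int v"
      show "count (pm_multiset v m n A) y = (if y \<in> subgrpJ v 1 then 0 else 2)"
      proof (cases "y = 0")
        case False
        have "int_rep v y \<noteq> 0" using y False by (simp add: int_rep_def)
        then have "\<bar>int_rep v y\<bar> \<in> {1..int ?N}" using int_rep_bounds[OF v, of y] by simp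
        then show ?thesis using R cnt[of y] J[of y] y False by simp
      qed (use cnt0 J y in auto)
    qed
  qed
  have le: "\<bar>B i j\<bar> \<le> int ?N" if "i < m" "j < n" for i j
    using int_rep_bounds[OF v] nz[OF that] the by (cases "B i j = 0") auto
  have rows: "(\<forall>i<m. card (row_cells n A i) = s) \<longleftrightarrow> (\<forall>i<m. card {j. j < n \<and> B i j \<noteq> 0} = s)"
    by (simp add: rc)
  have cols: "(\<forall>j<n. card (col_cells m A j) = k) \<longleftrightarrow> (\<forall>j<n. card {i. i < m \<and> B i j \<noteq> 0} = k)"
    by (simp add: cc)
  have row_sums: "(\<forall>i<m. (\<Sum>j\<in>row_cells n A i. int_rep v (the (A i j))) = 0) \<longleftrightarrow> (\<forall>i<m. (\<Sum>j<n. B i j) = 0)"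
    by (simp add: rs)
  have col_sums: "(\<forall>j<n. (\<Sum>i\<in>col_cells m A j. int_rep v (the (A i j))) = 0) \<longleftrightarrow> (\<forall>j<n. (\<Sum>i<m. B i j) = 0)"
    by (simp add: cs)
  have "(\<Sum>j\<in>row_cells n A i. the (A i j)) mod int v = (\<Sum>j<n. B i j) mod int v" if "i < m" for i
    using modsum[of "\<lambda>j. the (A i j)" "row_cells n A i"] rs[OF that] by (simp only:)
  then have "(\<forall>i<m. (\<Sum>j<n. B i j) = 0) \<Longrightarrow> \<forall>i<m. (\<Sum>j\<in>row_cells n A i. the (A i j)) mod int v = 0"
    by simp
  moreover have "(\<Sum>i\<in>col_cells m A j. the (A i j)) mod int v = (\<Sum>i<m. B i j) mod int v" if "j < n" for j
    using modsum[of "\<lambda>i. the (A i j)" "col_cells m A j"] cs[OF that] by (simp only:)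
  then have "(\<forall>j<n. (\<Sum>i<m. B i j) = 0) \<Longrightarrow> \<forall>j<n. (\<Sum>i\<in>col_cells m A j. the (A i j)) mod int v = 0"
    by simp
  moreover have "2 dvd 2 * n * k" "1 dvd 2 * n * k div 2" by simp_all
  ultimately show ?thesis
    unfolding integer_heffter_def heffter_def int_array_def Let_def hv rows cols row_sums col_sums cnt_iff
    using out range le by blast
qed

lemma ex_integer_heffter_iff:
  assumes k: "even k"
  shows "(\<exists>A. integer_heffter 2 1 m n s k A) \<longleftrightarrow> (\<exists>B. int_array m n s k B)"
proof -
  define v where "v = 2 * (n * k div 2) + 1"
  have hv: "hv 2 1 n k = v" using hv_2_1[OF k] by (simp add: v_def)
  show ?thesis
  proof
    assume "\<exists>A. integer_heffter 2 1 m n s k A"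
    then obtain A where A: "integer_heffter 2 1 m n s k A" by blast
    define B where "B = (\<lambda>i j. case A i j of None \<Rightarrow> 0 | Some x \<Rightarrow> int_rep v x)"
    have out: "\<And>i j. A i j \<noteq> None \<Longrightarrow> i < m \<and> j < n"
      and range: "\<And>i j x. A i j = Some x \<Longrightarrow> 0 \<le> x \<and> x < int v"
      and cnt: "count (pm_multiset v m n A) 0 = 0"
      using A unfolding integer_heffter_def heffter_def Let_def hv
      by (auto simp: subgrpJ_def v_def)
    \<comment> \<open>A filled cell holding 0 would give the residue 0 positive multiplicity, but 0
      lies in the excluded subgroup. Hence the value 0 is free to encode empty cells.\<close>
    have "x \<noteq> 0" if "A i j = Some x" for i j x
    proof -
      have "(i, j) \<in> filled_cells m n A" using that out[of i j] by (simp add: filled_cells_def)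
      then have "x mod int v \<noteq> 0"
        using cnt that finite_filled_cells[of m n A] by (force simp: count_pm_multiset)
      then show ?thesis by auto
    qed
    then have "int_rep v x \<noteq> 0" if "A i j = Some x" for i j x
      using range[OF that] that by (auto simp: int_rep_def Let_def)
    then have "integer_heffter 2 1 m n s k A \<longleftrightarrow> int_array m n s k B"
      by (intro integer_heffter_iff_int_array[OF k v_def] out range)
         (auto simp: B_def split: option.split)
    with A show "\<exists>B. int_array m n s k B" by blast
  next
    assume "\<exists>B. int_array m n s k B"
    then obtain B where B: "int_array m n s k B" by blast
    define A where "A = (\<lambda>i j. if i < m \<and> j < n \<and> B i j \<noteq> 0 then Some (B i j mod int v) else None)"
    have le: "\<bar>B i j\<bar> \<le> int (n * k div 2)" if "i < m" "j < n" for i j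
      using B that unfolding int_array_def by blast
    have "integer_heffter 2 1 m n s k A \<longleftrightarrow> int_array m n s k B"
    proof (rule integer_heffter_iff_int_array[OF k v_def])
      show "A i j = Some x \<Longrightarrow> B i j = int_rep v x" for i j x
        using le int_rep_mod_id[OF v_def] by (auto simp: A_def split: if_splits)
    qed (auto simp: A_def v_def split: if_splits)
    with B show "\<exists>A. integer_heffter 2 1 m n s k A" by blast
  qed
qed

subsection \<open>Arrays with two entries in each row\<close>

lemma two_entries:
  fixes f :: "nat \<Rightarrow> int"
  assumes "card {j. j < n \<and> f j \<noteq> 0} = 2" "(\<Sum>j<n. f j) = 0" "j < n" "f j \<noteq> 0"
  obtains j' where "j' < n" "j' \<noteq> j" "f j' = - f j"
proof -
  let ?S = "{j. j < n \<and> f j \<noteq> 0}"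
  have "card (?S - {j}) = 1" using assms by simp
  then obtain j' where j': "?S - {j} = {j'}" by (auto simp: card_1_singleton_iff)
  have "(\<Sum>j<n. f j) = sum f ?S" by (rule sum.mono_neutral_right) auto
  also have "\<dots> = f j + sum f (?S - {j})" using assms by (intro sum.remove) auto
  finally have "f j' = - f j" using assms(2) by (simp add: j')
  moreover have "j' < n" "j' \<noteq> j" using j' by auto
  ultimately show thesis using that by blast
qed

lemma three_cells_False:
  assumes B: "int_array m n s k B" and x: "x \<in> {1..int (n * k div 2)}"
    and C: "C \<subseteq> {(i, j). i < m \<and> j < n \<and> \<bar>B i j\<bar> = x}" "card C = 3"
  shows False
proof -
  have "finite {(i, j). i < m \<and> j < n \<and> \<bar>B i j\<bar> = x}"
    by (rule finite_subset[of _ "{..<m} \<times> {..<n}"]) auto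
  then have "card C \<le> card {(i, j). i < m \<and> j < n \<and> \<bar>B i j\<bar> = x}" using C(1) by (rule card_mono)
  also have "\<dots> = 2" using B x by (auto simp: int_array_def)
  finally show False using C(2) by simp
qed

lemma int_array_2_2_False:
  assumes B: "int_array m n 2 2 B" and "0 < n"
  shows False
proof -
  \<comment> \<open>The value 1 serves as an available absolute value because \<open>n\<close> is
    positive. A cell with it, its partner in the row and its partner in the column are three
    cells.\<close>
  have x: "1 \<in> {1..int (n * 2 div 2)}" using assms(2) by simp
  then have "card {(i, j). i < m \<and> j < n \<and> \<bar>B i j\<bar> = 1} = 2" using B by (auto simp: int_array_def)
  then have "{(i, j). i < m \<and> j < n \<and> \<bar>B i j\<bar> = 1} \<noteq> {}" by force
  then obtain i j where ij: "i < m" "j < n" "\<bar>B i j\<bar> = 1" by blast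
  then have nz: "B i j \<noteq> 0" by auto
  obtain j' where j': "j' < n" "j' \<noteq> j" "B i j' = - B i j"
    using two_entries[of n "B i" j] B ij nz by (auto simp: int_array_def)
  obtain i' where i': "i' < m" "i' \<noteq> i" "B i' j = - B i j"
    using two_entries[of m "\<lambda>i. B i j" i] B ij nz by (auto simp: int_array_def)
  show False
    by (rule three_cells_False[OF B x, of "{(i, j), (i, j'), (i', j)}"])
       (use ij i' j' in auto)
qed

text \<open>Every row is a pair \<open>x\<close>, \<open>-x\<close>, so the absolute values in
  column 0 run once through 1 to \<open>m\<close>, where \<open>m = k\<close>. The column sums to 0,
  so the sum of these absolute values, half of \<open>m * (m + 1)\<close>, is even. As
  \<open>m\<close> is even, \<open>m + 1\<close> is coprime to 4.\<close>

lemma int_array_two_columns: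
  assumes B: "int_array m 2 2 k B" and k: "even k"
  shows "k mod 4 = 0"
proof -
  have mk: "m = k" using filled_card[of m 2 B 2 k] B by (auto simp: int_array_def)
  have row: "B i 1 = - B i 0 \<and> B i 0 \<noteq> 0" if i: "i < m" for i
  proof -
    have sum0: "B i 0 + B i 1 = 0" using B i by (auto simp: int_array_def numeral_2_eq_2)
    have "B i 0 \<noteq> 0"
    proof
      assume "B i 0 = 0"
      then have "B i j = 0" if "j < 2" for j using less_2_cases[OF that] sum0 by auto
      then have "{j. j < 2 \<and> B i j \<noteq> 0} = {}" by blast
      then have "card {j. j < 2 \<and> B i j \<noteq> 0} = 0" by (simp only: card.empty)
      moreover have "card {j. j < 2 \<and> B i j \<noteq> 0} = 2" using B i by (auto simp: int_array_def)
      ultimately show False by linarith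
    qed
    with sum0 show ?thesis by simp
  qed
  have range: "\<bar>B i 0\<bar> \<in> {1..int m}" if "i < m" for i
    using B row[OF that] that mk by (auto simp: int_array_def)
  have inj: "inj_on (\<lambda>i. \<bar>B i 0\<bar>) {..<m}"
  proof (rule inj_onI, rule ccontr)
    fix i i' assume i: "i \<in> {..<m}" "i' \<in> {..<m}" "\<bar>B i 0\<bar> = \<bar>B i' 0\<bar>" "i \<noteq> i'"
    show False
      by (rule three_cells_False[OF B, of "\<bar>B i 0\<bar>" "{(i, 0), (i, 1), (i', 0)}"])
         (use i row range mk in auto)
  qed
  have "(\<lambda>i. \<bar>B i 0\<bar>) ` {..<m} = {1..int m}"
    using range inj by (intro card_subset_eq) (auto simp: card_image)
  then have "(\<Sum>i<m. \<bar>B i 0\<bar>) = \<Sum>{1..int m}" using sum.reindex[OF inj, of "\<lambda>x. x"] by simp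
  also have "2 * \<dots> = int m * (int m + 1)"
  proof (induction m)
    case (Suc m)
    have "{1..int (Suc m)} = insert (int m + 1) {1..int m}" by auto
    then show ?case using Suc by (simp add: algebra_simps)
  qed simp
  finally have eq: "2 * (\<Sum>i<m. \<bar>B i 0\<bar>) = int m * (int m + 1)" by simp
  have "(\<Sum>i<m. B i 0) = 0" using B by (auto simp: int_array_def)
  \<comment> \<open>Subtracting the zero column sum leaves terms of the form
    \<open>\<bar>b\<bar> - b\<close>, each of which is even.\<close>
  then have "(\<Sum>i<m. \<bar>B i 0\<bar>) = (\<Sum>i<m. \<bar>B i 0\<bar> - B i 0)" by (simp add: sum_subtractf)
  also have "even \<dots>" by (rule dvd_sum) simp
  finally have "4 dvd int m * (int m + 1)" unfolding eq[symmetric] by auto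
  moreover have "coprime (4::int) (int m + 1)"
  proof -
    have "coprime ((2::int)^2) (int m + 1)" using k mk by (subst coprime_power_left_iff) simp
    then show ?thesis by simp
  qed
  ultimately have "4 dvd int m" by (simp add: coprime_dvd_mult_left_iff)
  then show ?thesis using mk by presburger
qed

subsection \<open>An even number of columns\<close>

lemma sum_lessThan_add:
  fixes f :: "nat \<Rightarrow> 'a::comm_monoid_add"
  shows "sum f {..<a + b} = sum f {..<a} + (\<Sum>i<b. f (a + i))"
  by (induction b) (simp_all add: add.assoc)

lemma card_less_conj: "card {e. e < (N :: nat) \<and> P e} = (\<Sum>e<N. of_bool (P e))"
  by (simp add: Int_def)

lemma card_incident:
  fixes N :: nat
  assumes "\<And>e. e < N \<Longrightarrow> src e \<noteq> tgt e"
  shows "card {e. e < N \<and> v \<in> {src e, tgt e}}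
    = (\<Sum>e<N. of_bool (src e = v)) + (\<Sum>e<N. of_bool (tgt e = v))"
proof -
  have "card {e. e < N \<and> v \<in> {src e, tgt e}} = (\<Sum>e<N. of_bool (v \<in> {src e, tgt e}))"
    by (rule card_less_conj)
  also have "\<dots> = (\<Sum>e<N. of_bool (src e = v) + of_bool (tgt e = v))"
  proof (rule sum.cong)
    fix e assume "e \<in> {..<N}"
    then show "of_bool (v \<in> {src e, tgt e}) = (of_bool (src e = v) + of_bool (tgt e = v) :: nat)"
      using assms[of e] by auto
  qed simp
  finally show ?thesis by (simp only: sum.distrib)
qed

lemma bij_betw_int_succ: "bij_betw (\<lambda>e. int e + 1) {a..<b} {int a + 1..int b}"
  by (rule bij_betw_byWitness[where f' = "\<lambda>x. nat (x - 1)"]) auto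

text \<open>Edge e carries the flow e + 1. Since in- and out-degrees agree, all flows may be shifted by
  a constant, which is why the balance condition can be stated with e in place of e + 1.\<close>

definition flow_graph :: "nat \<Rightarrow> nat \<Rightarrow> (nat \<Rightarrow> nat) \<Rightarrow> (nat \<Rightarrow> nat) \<Rightarrow> (nat \<Rightarrow> nat) \<Rightarrow> bool" where
  "flow_graph n h src tgt c \<longleftrightarrow>
     (\<forall>e<n * h. src e < n \<and> tgt e < n \<and> src e \<noteq> tgt e \<and> c e < 2 * h)
   \<and> (\<forall>e<n * h. \<forall>f<n * h. e \<noteq> f \<longrightarrow> c e = c f \<longrightarrow> {src e, tgt e} \<inter> {src f, tgt f} = {})
   \<and> (\<forall>v<n. (\<Sum>e<n * h. of_bool (src e = v)) = h)
   \<and> (\<forall>v<n. (\<Sum>e<n * h. of_bool (tgt e = v)) = h)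
   \<and> (\<forall>v<n. (\<Sum>e<n * h. e * of_bool (src e = v)) = (\<Sum>e<n * h. e * of_bool (tgt e = v)))"

definition flow_graph_ex :: "nat \<Rightarrow> nat \<Rightarrow> bool" where
  "flow_graph_ex n h \<longleftrightarrow> (\<exists>src tgt c. flow_graph n h src tgt c)"

lemma flow_graph_ex_0 [simp]: "flow_graph_ex 0 h" "flow_graph_ex n 0"
  by (auto simp: flow_graph_ex_def flow_graph_def)

text \<open>The second graph has its vertices shifted by \<open>n1\<close> and its edge numbers by
  \<open>n1 * h\<close>. Colours can be shared, since the two parts have no common vertex.\<close>

lemma flow_graph_ex_disjoint_union:
  assumes "flow_graph_ex n1 h" "flow_graph_ex n2 h"
  shows "flow_graph_ex (n1 + n2) h"
proof -
  obtain s1 t1 c1 s2 t2 c2 where G1: "flow_graph n1 h s1 t1 c1" and G2: "flow_graph n2 h s2 t2 c2"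
    using assms by (auto simp: flow_graph_ex_def)
  define glue where "glue = (\<lambda>(g1 :: nat \<Rightarrow> nat) g2 e. if e < n1 * h then g1 e else n1 + g2 (e - n1 * h) :: nat)"
  define c where "c = (\<lambda>e. if e < n1 * h then c1 e else c2 (e - n1 * h))"
  have N: "(n1 + n2) * h = n1 * h + n2 * h" by (simp add: add_mult_distrib)
  have deg: "(\<Sum>e<n1 * h + n2 * h. of_bool (glue g1 g2 e = v)) = h"
    if "\<forall>e<n1 * h. g1 e < n1" "\<forall>v<n1. (\<Sum>e<n1 * h. of_bool (g1 e = v)) = h"
      "\<forall>v<n2. (\<Sum>e<n2 * h. of_bool (g2 e = v)) = h" "v < n1 + n2" for g1 g2 v
  proof (cases "v < n1")
    case True
    then show ?thesis using that by (simp add: sum_lessThan_add glue_def of_bool_def)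
  next
    case False
    then have u: "v = n1 + (v - n1)" "v - n1 < n2" using that(4) by auto
    define u where "u = v - n1"
    note u = u[folded u_def]
    have "(\<Sum>e<n1 * h. of_bool (glue g1 g2 e = v)) = (0::nat)"
      by (rule sum.neutral) (use that u in \<open>auto simp: glue_def\<close>)
    then show ?thesis using that u by (simp add: sum_lessThan_add glue_def)
  qed
  \<comment> \<open>Renumbering adds \<open>n1 * h\<close> to each of the \<open>h\<close> edges out
    of a vertex of the second part and to each of the \<open>h\<close> edges into it, so balance is
    preserved.\<close>
  have wt: "(\<Sum>e<n1 * h + n2 * h. e * of_bool (glue g1 g2 e = v))
      = (if v < n1 then \<Sum>e<n1 * h. e * of_bool (g1 e = v)
         else n1 * h * h + (\<Sum>e<n2 * h. e * of_bool (g2 e = v - n1)))"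
    if "\<forall>e<n1 * h. g1 e < n1" "\<forall>v<n2. (\<Sum>e<n2 * h. of_bool (g2 e = v)) = h" "v < n1 + n2" for g1 g2 v
  proof (cases "v < n1")
    case True
    then show ?thesis by (simp add: sum_lessThan_add glue_def of_bool_def)
  next
    case False
    then have u: "v = n1 + (v - n1)" "v - n1 < n2" using that(3) by auto
    define u where "u = v - n1"
    note u = u[folded u_def]
    have "(\<Sum>e<n1 * h. e * of_bool (glue g1 g2 e = v)) = 0"
      by (rule sum.neutral) (use that u in \<open>auto simp: glue_def\<close>)
    moreover have "(\<Sum>i<n2 * h. (n1 * h + i) * of_bool (g2 i = u))
        = n1 * h * (\<Sum>i<n2 * h. of_bool (g2 i = u)) + (\<Sum>i<n2 * h. i * of_bool (g2 i = u))"
      by (simp only: sum_distrib_left add_mult_distrib sum.distrib)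
    ultimately show ?thesis using that u by (simp add: sum_lessThan_add glue_def)
  qed
  have st: "\<forall>e<n1 * h. s1 e < n1" "\<forall>e<n1 * h. t1 e < n1"
    using G1 unfolding flow_graph_def by blast+
  have G1_deg: "\<forall>v<n1. (\<Sum>e<n1 * h. of_bool (s1 e = v)) = h" "\<forall>v<n1. (\<Sum>e<n1 * h. of_bool (t1 e = v)) = h"
    using G1 unfolding flow_graph_def by blast+
  have G2_deg: "\<forall>v<n2. (\<Sum>e<n2 * h. of_bool (s2 e = v)) = h" "\<forall>v<n2. (\<Sum>e<n2 * h. of_bool (t2 e = v)) = h"
    using G2 unfolding flow_graph_def by blast+
  have "flow_graph (n1 + n2) h (glue s1 s2) (glue t1 t2) c"
    unfolding flow_graph_def N
  proof (intro conjI)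
    show "\<forall>v<n1 + n2. (\<Sum>e<n1 * h + n2 * h. of_bool (glue s1 s2 e = v)) = h"
      "\<forall>v<n1 + n2. (\<Sum>e<n1 * h + n2 * h. of_bool (glue t1 t2 e = v)) = h"
      using deg[OF st(1) G1_deg(1) G2_deg(1)] deg[OF st(2) G1_deg(2) G2_deg(2)] by blast+
    show "\<forall>v<n1 + n2. (\<Sum>e<n1 * h + n2 * h. e * of_bool (glue s1 s2 e = v))
        = (\<Sum>e<n1 * h + n2 * h. e * of_bool (glue t1 t2 e = v))"
      using G1 G2 wt[of s1 s2] wt[of t1 t2] by (auto simp: flow_graph_def)
    have sub: "e - n1 * h < n2 * h" if "e < n1 * h + n2 * h" "\<not> e < n1 * h" for e using that by auto
    then show "\<forall>e<n1 * h + n2 * h. glue s1 s2 e < n1 + n2 \<and> glue t1 t2 e < n1 + n2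
        \<and> glue s1 s2 e \<noteq> glue t1 t2 e \<and> c e < 2 * h"
      using G1 G2 by (auto simp: flow_graph_def glue_def c_def trans_less_add1)
    show "\<forall>e<n1 * h + n2 * h. \<forall>f<n1 * h + n2 * h. e \<noteq> f \<longrightarrow> c e = c f \<longrightarrow>
        {glue s1 s2 e, glue t1 t2 e} \<inter> {glue s1 s2 f, glue t1 t2 f} = {}"
    proof (intro allI impI)
      fix e f assume ef: "e < n1 * h + n2 * h" "f < n1 * h + n2 * h" "e \<noteq> f" "c e = c f"
      have 1: "s1 g < n1" "t1 g < n1" if "g < n1 * h" for g using G1 that by (auto simp: flow_graph_def)
      have 2: "{s1 e, t1 e} \<inter> {s1 f, t1 f} = {}" if "e < n1 * h" "f < n1 * h"
        using G1 that ef unfolding flow_graph_def c_def by metis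
      have 3: "{s2 (e - n1 * h), t2 (e - n1 * h)} \<inter> {s2 (f - n1 * h), t2 (f - n1 * h)} = {}"
        if "\<not> e < n1 * h" "\<not> f < n1 * h"
      proof -
        have "e - n1 * h \<noteq> f - n1 * h" using that ef(3) by auto
        moreover have "c2 (e - n1 * h) = c2 (f - n1 * h)" using that ef(4) by (simp add: c_def)
        ultimately show ?thesis using G2 sub[OF ef(1) that(1)] sub[OF ef(2) that(2)]
          unfolding flow_graph_def by blast
      qed
      show "{glue s1 s2 e, glue t1 t2 e} \<inter> {glue s1 s2 f, glue t1 t2 f} = {}"
        using 1[of e] 1[of f] 2 3 by (cases "e < n1 * h"; cases "f < n1 * h") (auto simp: glue_def)
    qed
  qed
  then show ?thesis by (auto simp: flow_graph_ex_def)
qed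

text \<open>Both graphs share their vertices, so the second receives fresh colours, shifted by
  \<open>2 * h1\<close>. Its edge numbers are shifted by \<open>n * h1\<close>, which changes the
  outflow and inflow at a vertex equally because both degrees are \<open>h2\<close>.\<close>

lemma flow_graph_ex_overlay:
  assumes "flow_graph_ex n h1" "flow_graph_ex n h2"
  shows "flow_graph_ex n (h1 + h2)"
proof -
  obtain s1 t1 c1 s2 t2 c2 where G1: "flow_graph n h1 s1 t1 c1" and G2: "flow_graph n h2 s2 t2 c2"
    using assms by (auto simp: flow_graph_ex_def)
  define glue where "glue = (\<lambda>(g1 :: nat \<Rightarrow> nat) (g2 :: nat \<Rightarrow> nat) e. if e < n * h1 then g1 e else g2 (e - n * h1))"
  define c where "c = (\<lambda>e. if e < n * h1 then c1 e else 2 * h1 + c2 (e - n * h1))"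
  have N: "n * (h1 + h2) = n * h1 + n * h2" by (simp add: add_mult_distrib2)
  have deg: "(\<Sum>e<n * h1 + n * h2. of_bool (glue g1 g2 e = v))
      = (\<Sum>e<n * h1. of_bool (g1 e = v)) + (\<Sum>e<n * h2. of_bool (g2 e = v))" for g1 g2 and v :: nat
    by (simp add: sum_lessThan_add glue_def del: sum_of_bool_eq)
  have wt: "(\<Sum>e<n * h1 + n * h2. e * of_bool (glue g1 g2 e = v))
      = (\<Sum>e<n * h1. e * of_bool (g1 e = v)) + (\<Sum>e<n * h2. e * of_bool (g2 e = v))
        + n * h1 * (\<Sum>e<n * h2. of_bool (g2 e = v))" for g1 g2 v
  proof -
    have "(\<Sum>i<n * h2. (n * h1 + i) * of_bool (g2 i = v))
        = n * h1 * (\<Sum>i<n * h2. of_bool (g2 i = v)) + (\<Sum>i<n * h2. i * of_bool (g2 i = v))"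
      by (simp only: sum_distrib_left add_mult_distrib sum.distrib)
    moreover have "(\<Sum>e<n * h1 + n * h2. e * of_bool (glue g1 g2 e = v))
      = (\<Sum>e<n * h1. e * of_bool (g1 e = v)) + (\<Sum>i<n * h2. (n * h1 + i) * of_bool (g2 i = v))"
      unfolding sum_lessThan_add by (intro arg_cong2[of _ _ _ _ "(+)"] sum.cong) (auto simp: glue_def)
    ultimately show ?thesis by linarith
  qed
  have "flow_graph n (h1 + h2) (glue s1 s2) (glue t1 t2) c"
    unfolding flow_graph_def N
  proof (intro conjI)
    show "\<forall>v<n. (\<Sum>e<n * h1 + n * h2. of_bool (glue s1 s2 e = v)) = h1 + h2"
      "\<forall>v<n. (\<Sum>e<n * h1 + n * h2. of_bool (glue t1 t2 e = v)) = h1 + h2"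
      using G1 G2 unfolding deg flow_graph_def by auto
    show "\<forall>v<n. (\<Sum>e<n * h1 + n * h2. e * of_bool (glue s1 s2 e = v))
        = (\<Sum>e<n * h1 + n * h2. e * of_bool (glue t1 t2 e = v))"
      using G1 G2 unfolding wt flow_graph_def by auto
    have sub: "e - n * h1 < n * h2" if "e < n * h1 + n * h2" "\<not> e < n * h1" for e using that by auto
    then show "\<forall>e<n * h1 + n * h2. glue s1 s2 e < n \<and> glue t1 t2 e < n
        \<and> glue s1 s2 e \<noteq> glue t1 t2 e \<and> c e < 2 * (h1 + h2)"
      using G1 G2 by (auto simp: flow_graph_def glue_def c_def trans_less_add1)
    show "\<forall>e<n * h1 + n * h2. \<forall>f<n * h1 + n * h2. e \<noteq> f \<longrightarrow> c e = c f \<longrightarrow>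
        {glue s1 s2 e, glue t1 t2 e} \<inter> {glue s1 s2 f, glue t1 t2 f} = {}"
    proof (intro allI impI)
      fix e f assume ef: "e < n * h1 + n * h2" "f < n * h1 + n * h2" "e \<noteq> f" "c e = c f"
      have "c1 g < 2 * h1" if "g < n * h1" for g using G1 that by (auto simp: flow_graph_def)
      \<comment> \<open>The two colour ranges do not overlap, so edges of equal colour come from the
        same graph.\<close>
      then have 1: "e < n * h1 \<longleftrightarrow> f < n * h1" using ef(4) unfolding c_def by (auto split: if_splits) (metis not_add_less1)+
      show "{glue s1 s2 e, glue t1 t2 e} \<inter> {glue s1 s2 f, glue t1 t2 f} = {}"
      proof (cases "e < n * h1")
        case True
        have "c1 e = c1 f" using ef True 1 by (simp add: c_def)
        then have "{s1 e, t1 e} \<inter> {s1 f, t1 f} = {}"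
          using G1 True 1 ef unfolding flow_graph_def by blast
        then show ?thesis using True 1 by (simp add: glue_def)
      next
        case False
        have "e - n * h1 \<noteq> f - n * h1" using False 1 ef(3) by auto
        moreover have "c2 (e - n * h1) = c2 (f - n * h1)" using ef False 1 by (simp add: c_def)
        ultimately have "{s2 (e - n * h1), t2 (e - n * h1)} \<inter> {s2 (f - n * h1), t2 (f - n * h1)} = {}"
          using G2 sub[OF ef(1)] sub[OF ef(2)] False 1 unfolding flow_graph_def by blast
        then show ?thesis using False 1 by (simp add: glue_def)
      qed
    qed
  qed
  then show ?thesis by (auto simp: flow_graph_ex_def)
qed

section \<open>Evaluation of three small concrete flow graphs\<close>

lemma all_less_upt: "(\<forall>e<n. P e) \<longleftrightarrow> list_all P [0..<n]"
  by (auto simp: list_all_iff)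

lemma sum_lessThan_upt: "(\<Sum>e<n. f e) = (\<Sum>e\<leftarrow>[0..<n]. f e)"
  by (simp add: interv_sum_list_conv_sum_set_nat atLeast0LessThan)

lemma upt_0_literals:
  "[0..<2] = [0,1]"
  "[0..<4] = [0,1,2,3]"
  "[0..<6] = [0,1,2,3,4,5]"
  "[0..<12] = [0,1,2,3,4,5,6,7,8,9,10,11]"
  "[0..<18] = [0,1,2,3,4,5,6,7,8,9,10,11,12,13,14,15,16,17]"
  by (simp_all add: upt_rec)

text \<open>Edges 0 and 3 go one way and edges 1 and 2 the other; balance is 0 + 3 = 1 + 2.\<close>

lemma flow_graph_ex_2_2: "flow_graph_ex 2 2"
proof -
  have "flow_graph 2 2 ((!) [0,1,1,0]) ((!) [1,0,0,1]) ((!) [0,1,2,3])"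
    unfolding flow_graph_def all_less_upt sum_lessThan_upt
    by (intro conjI; simp add: upt_0_literals del: upt_rec_numeral)
  then show ?thesis by (auto simp: flow_graph_ex_def)
qed

text \<open>An explicit 6-regular multigraph whose six colour classes are perfect matchings. Two
  vertices would not do for \<open>h = 3\<close>: the flows 1 to 6 have the odd total 21 and cannot
  be split equally between the two directions.\<close>

lemma flow_graph_ex_4_3: "flow_graph_ex 4 3"
proof -
  have "flow_graph 4 3 ((!) [2,2,1,0,3,3,0,1,0,1,3,2]) ((!) [1,0,3,2,2,2,3,0,1,0,1,3])
    ((!) [1,5,3,3,0,4,1,0,4,2,5,2])"
    unfolding flow_graph_def all_less_upt sum_lessThan_upt
    by (intro conjI; simp add: upt_0_literals del: upt_rec_numeral)
  then show ?thesis by (auto simp: flow_graph_ex_def)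
qed

lemma flow_graph_ex_6_3: "flow_graph_ex 6 3"
proof -
  have "flow_graph 6 3 ((!) [0,5,3,4,1,4,2,0,3,1,2,0,5,2,3,1,5,4])
    ((!) [4,1,0,3,0,5,3,2,2,4,1,5,0,5,2,3,4,1]) ((!) [3,3,0,2,5,1,3,1,5,0,2,2,4,0,4,1,5,4])"
    unfolding flow_graph_def all_less_upt sum_lessThan_upt
    by (intro conjI; simp add: upt_0_literals del: upt_rec_numeral)
  then show ?thesis by (auto simp: flow_graph_ex_def)
qed

text \<open>Copies of the graph on two vertices are first superposed \<open>j\<close> times, then
  \<open>i\<close> such graphs are placed side by side.\<close>

lemma flow_graph_ex_even_even: "flow_graph_ex (2 * i) (2 * j)"
proof -
  have "flow_graph_ex 2 (2 * j)"
  proof (induction j)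
    case (Suc j)
    then show ?case using flow_graph_ex_overlay[OF flow_graph_ex_2_2] by force
  qed simp
  then show ?thesis
  proof (induction i)
    case (Suc i)
    then show ?case using flow_graph_ex_disjoint_union[of 2 "2 * j" "2 * i"] by simp
  qed simp
qed

text \<open>Every even number from 4 on is a sum of fours and at most one 6.\<close>

lemma flow_graph_ex_even_3:
  assumes "2 \<le> i"
  shows "flow_graph_ex (2 * i) 3"
  using assms
proof (induction i rule: less_induct)
  case (less i)
  consider "i = 2" | "i = 3" | "4 \<le> i" using less.prems by linarith
  then show ?case
  proof cases
    case 3
    then have "flow_graph_ex (2 * (i - 2)) 3" using less.IH[of "i - 2"] by simp
    from flow_graph_ex_disjoint_union[OF flow_graph_ex_4_3 this] show ?thesis
      using 3 by (simp add: algebra_simps)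
  qed (use flow_graph_ex_4_3 flow_graph_ex_6_3 in simp_all)
qed

text \<open>An odd \<open>h\<close> is at least 3 here and splits as 3 plus an even number; the two
  layers are superposed.\<close>

lemma flow_graph_ex_even:
  assumes "even n" "2 \<le> h" "n = 2 \<longrightarrow> even h" "0 < n"
  shows "flow_graph_ex n h"
proof -
  obtain i where i: "n = 2 * i" using assms(1) by blast
  show ?thesis
  proof (cases "even h")
    case True
    then show ?thesis using flow_graph_ex_even_even i by blast
  next
    case False
    then have "i \<noteq> 1" "h \<noteq> 2" using assms(3) i by auto
    then have "2 \<le> i" "3 \<le> h" using assms(2,4) i by linarith+
    moreover have "even (h - 3)" using False by simp
    ultimately show ?thesis
      using flow_graph_ex_overlay[OF flow_graph_ex_even_3[of i] flow_graph_ex_even_even[of i "(h - 3) div 2"]] i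
      by simp
  qed
qed

text \<open>The colouring of the flow graph uses only \<open>2 * h\<close> colours; viewed as a
  colouring with \<open>m\<close> colours it is made equitable by \<open>int_array_of_graph\<close>,
  which fills all \<open>m\<close> rows evenly.\<close>

lemma int_array_even_columns:
  assumes "flow_graph_ex n h" and N: "m * q = n * h" and m: "2 * h \<le> m"
  shows "\<exists>B. int_array m n (2 * q) (2 * h) B"
proof -
  obtain src tgt c where G: "flow_graph n h src tgt c" using assms(1) by (auto simp: flow_graph_ex_def)
  show ?thesis
  proof (rule int_array_of_graph[where N = "n * h" and src = src and tgt = tgt and col = c and w = "\<lambda>e. int e + 1"])
    show "proper_col (\<lambda>e. {src e, tgt e}) {..<n * h} m c"
      using G m unfolding flow_graph_def proper_col_def by (auto intro: less_le_trans)
    fix v assume v: "v < n"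
    have ne: "e < n * h \<Longrightarrow> src e \<noteq> tgt e" for e using G by (auto simp: flow_graph_def)
    show "card {e. e < n * h \<and> v \<in> {src e, tgt e}} = 2 * h"
      using card_incident[of "n * h" src tgt v, OF ne] G v by (simp add: flow_graph_def)
    have "(\<Sum>e<n * h. (int e + 1) * of_bool (g e = v))
        = int (\<Sum>e<n * h. e * of_bool (g e = v)) + int (\<Sum>e<n * h. of_bool (g e = v))" for g :: "nat \<Rightarrow> nat"
      unfolding of_nat_sum sum.distrib[symmetric] by (rule sum.cong) (auto simp: algebra_simps)
    then show "(\<Sum>e<n * h. (int e + 1) * of_bool (src e = v)) = (\<Sum>e<n * h. (int e + 1) * of_bool (tgt e = v))"
      using G v by (simp only: flow_graph_def)
  next
    show "bij_betw (\<lambda>e. \<bar>int e + 1\<bar>) {..<n * h} {1..int (n * h)}"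
      using bij_betw_int_succ[of 0 "n * h"] by (simp add: atLeast0LessThan)
  qed (use G N in \<open>auto simp: flow_graph_def\<close>)
qed

subsection \<open>An odd number of columns\<close>

text \<open>This is an \<open>h\<close> by \<open>n\<close> rectangle read row by row, with row
  \<open>p\<close> and column \<open>r\<close>. Its signed entries use each absolute value once, and
  all column sums are equal, as in a magic rectangle without a condition on the rows.\<close>

definition const_weights :: "nat \<Rightarrow> nat \<Rightarrow> (nat \<Rightarrow> int) \<Rightarrow> int \<Rightarrow> bool" where
  "const_weights n h W C \<longleftrightarrow> bij_betw (\<lambda>t. \<bar>W t\<bar>) {..<n * h} {1..int (n * h)}
     \<and> (\<forall>r<n. (\<Sum>p<h. W (p * n + r)) = C)"

lemma const_weights_0: "const_weights n 0 W 0"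
  by (simp add: const_weights_def bij_betw_def)

lemma bij_betw_of_inj:
  assumes "inj_on f A" "f ` A \<subseteq> B" "finite B" "card A = card B"
  shows "bij_betw f A B"
  using assms by (metis bij_betw_def card_image card_subset_eq)

text \<open>The three rows carry the consecutive ranges of length \<open>n\<close>, arranged by the
  identity, \<open>y\<close> and \<open>z\<close>. These are permutations of 0 to
  \<open>2 * g\<close> with \<open>r + y r + z r = 3 * g\<close>, also known as a Kotzig
  array.\<close>

lemma const_weights_3:
  assumes n: "n = 2 * g + 1"
  shows "\<exists>W C. const_weights n 3 W C"
proof -
  define y where "y = (\<lambda>j. if even j then 2 * g - j div 2 else g - 1 - j div 2)"
  define z where "z = (\<lambda>j. if even j then g - j div 2 else 2 * g - j div 2)"
  define W where "W = (\<lambda>t. int (if t < n then t + 1 else if t < 2 * n then n + 1 + y (t - n)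
    else 2 * n + 1 + z (t - 2 * n)))"
  have yn: "y j < n" and zn: "z j < n" for j using n by (auto simp: y_def z_def)
  \<comment> \<open>Writing \<open>r\<close> as \<open>2 * a\<close> or \<open>2 * a + 1\<close>
    removes the divisions and truncated subtractions, so that linear arithmetic settles the sum and
    both injectivity claims.\<close>
  have yz_cases: "\<exists>a. (r = 2 * a \<and> y r + a = 2 * g \<and> z r + a = g)
      \<or> (r = 2 * a + 1 \<and> y r + 1 + a = g \<and> z r + a = 2 * g)" if "r < n" for r
  proof (cases "even r")
    case True
    then obtain a where "r = 2 * a" by blast
    then show ?thesis using that n by (intro exI[of _ a]) (simp add: y_def z_def)
  next
    case False
    then obtain a where "r = 2 * a + 1" by (auto elim: oddE)
    then show ?thesis using that n by (intro exI[of _ a]) (simp add: y_def z_def)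
  qed
  have yi: "i = j" if "i < n" "j < n" "y i = y j" for i j
    using yz_cases[OF that(1)] yz_cases[OF that(2)] that(3) by (elim exE disjE; linarith)
  have zi: "i = j" if "i < n" "j < n" "z i = z j" for i j
    using yz_cases[OF that(1)] yz_cases[OF that(2)] that(3) by (elim exE disjE; linarith)
  have yz: "r + y r + z r = 3 * g" if "r < n" for r
    using yz_cases[OF that] by (elim exE disjE; linarith)
  have "bij_betw (\<lambda>t. \<bar>W t\<bar>) {..<n * 3} {1..int (n * 3)}"
  proof (rule bij_betw_of_inj)
    show "(\<lambda>t. \<bar>W t\<bar>) ` {..<n * 3} \<subseteq> {1..int (n * 3)}"
    proof (intro image_subsetI)
      fix t assume "t \<in> {..<n * 3}"
      then show "\<bar>W t\<bar> \<in> {1..int (n * 3)}"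
        using yn[of "t - n"] zn[of "t - 2 * n"] by (auto simp: W_def)
    qed
    show "inj_on (\<lambda>t. \<bar>W t\<bar>) {..<n * 3}"
    proof (rule inj_onI)
      fix t u assume tu: "t \<in> {..<n * 3}" "u \<in> {..<n * 3}" "\<bar>W t\<bar> = \<bar>W u\<bar>"
      have blocks: "\<bar>W t\<bar> \<le> int n \<longleftrightarrow> t < n" "\<bar>W t\<bar> \<le> int (2 * n) \<longleftrightarrow> t < 2 * n" for t
        using yn[of "t - n"] by (auto simp: W_def)
      have same: "t < n \<longleftrightarrow> u < n" "t < 2 * n \<longleftrightarrow> u < 2 * n"
        unfolding blocks[symmetric] tu(3) by (rule refl)+
      consider "t < n" | "\<not> t < n" "t < 2 * n" | "\<not> t < 2 * n" by linarith
      then show "t = u"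
      proof cases
        case 1
        then show ?thesis using tu(3) same by (simp add: W_def)
      next
        case 2
        then have "y (t - n) = y (u - n)" using tu(3) same by (simp add: W_def)
        then have "t - n = u - n" by (rule yi[rotated 2]) (use 2 same in auto)
        then show ?thesis using 2 same by linarith
      next
        case 3
        then have "z (t - 2 * n) = z (u - 2 * n)" using tu(3) same by (simp add: W_def)
        then have "t - 2 * n = u - 2 * n" by (rule zi[rotated 2]) (use 3 same tu(1,2) in auto)
        then show ?thesis using 3 same by linarith
      qed
    qed
  qed auto
  moreover have "(\<Sum>p<3. W (p * n + r)) = int (3 * n + 3 + 3 * g)" if r: "r < n" for r
  proof -
    have "(\<Sum>p<3. W (p * n + r)) = W r + W (n + r) + W (2 * n + r)"
      by (simp add: numeral_3_eq_3 mult_2 add.assoc)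
    also have "\<dots> = int (3 * n + 3 + (r + y r + z r))" using r by (simp add: W_def)
    finally show ?thesis using yz[OF r] by simp
  qed
  ultimately show ?thesis unfolding const_weights_def by blast
qed

text \<open>Two rows are appended: the next \<open>n\<close> numbers with positive sign, then the
  following \<open>n\<close> with negative sign. In each column they contribute
  \<open>- int n\<close>.\<close>

lemma const_weights_step:
  assumes "const_weights n h W C"
  shows "\<exists>W' C'. const_weights n (h + 2) W' C'"
proof -
  define W' where "W' = (\<lambda>t. if t < n * h then W t else if t < n * (h + 1) then int t + 1 else - (int t + 1))"
  have "bij_betw (\<lambda>t. \<bar>W' t\<bar>) ({..<n * h} \<union> {n * h..<n * (h + 2)})
      ({1..int (n * h)} \<union> {int (n * h) + 1..int (n * (h + 2))})"
  proof (rule bij_betw_combine)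
    have "bij_betw (\<lambda>t. \<bar>W t\<bar>) {..<n * h} {1..int (n * h)}"
      using assms by (simp add: const_weights_def)
    then show "bij_betw (\<lambda>t. \<bar>W' t\<bar>) {..<n * h} {1..int (n * h)}"
      by (rule bij_betw_cong[THEN iffD1, rotated]) (simp add: W'_def)
    have "bij_betw (\<lambda>t. int t + 1) {n * h..<n * (h + 2)} {int (n * h) + 1..int (n * (h + 2))}"
      by (rule bij_betw_int_succ)
    then show "bij_betw (\<lambda>t. \<bar>W' t\<bar>) {n * h..<n * (h + 2)} {int (n * h) + 1..int (n * (h + 2))}"
      by (rule bij_betw_cong[THEN iffD1, rotated]) (simp add: W'_def)
  qed auto
  moreover have "{..<n * h} \<union> {n * h..<n * (h + 2)} = {..<n * (h + 2)}"
    by (rule ivl_disj_un) simp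
  moreover have "{1..a} \<union> {a + 1..b} = {1..b}" if "0 \<le> a" "a \<le> b" for a b :: int
    using that by auto
  then have "{1..int (n * h)} \<union> {int (n * h) + 1..int (n * (h + 2))} = {1..int (n * (h + 2))}"
    by simp
  moreover have "(\<Sum>p<h + 2. W' (p * n + r)) = C - int n" if r: "r < n" for r
  proof -
    have "p * n + r < n * h" if "p < h" for p
    proof -
      have "p * n + r < (p + 1) * n" using r by simp
      also have "\<dots> \<le> h * n" using that by (intro mult_le_mono1) simp
      finally show ?thesis by (simp add: mult.commute)
    qed
    then have "(\<Sum>p<h. W' (p * n + r)) = (\<Sum>p<h. W (p * n + r))"
      by (intro sum.cong) (auto simp: W'_def)
    moreover have "W' (h * n + r) + W' (Suc h * n + r) = - int n"
      using r by (simp add: W'_def algebra_simps)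
    ultimately show ?thesis using assms r by (simp add: const_weights_def)
  qed
  ultimately have "const_weights n (h + 2) W' (C - int n)" by (simp add: const_weights_def)
  then show ?thesis by blast
qed

text \<open>Steps of 2 from the empty rectangle and from \<open>h = 3\<close> reach every height
  except 1.\<close>

lemma const_weights_ex:
  assumes "odd n" "h \<noteq> 1"
  shows "\<exists>W C. const_weights n h W C"
  using assms(2)
proof (induction h rule: less_induct)
  case (less h)
  consider "h = 0" | "h = 3" | h' where "h = h' + 2" "h' \<noteq> 1"
    using less.prems by (metis One_nat_def Suc_1 add_2_eq_Suc' less_2_cases not_less_eq numeral_3_eq_3 old.nat.exhaust add.commute one_add_one)
  then show ?case
  proof cases
    case 1
    then show ?thesis using const_weights_0 by blast
  next
    case 2
    then show ?thesis using const_weights_3 assms(1) by (metis oddE)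
  next
    case 3
    then show ?thesis using less.IH[of h'] const_weights_step by auto
  qed
qed

section \<open>Doubling modulo an odd number\<close>

lemma sum_regroup:
  fixes f :: "nat \<Rightarrow> 'a::comm_monoid_add"
  shows "(\<Sum>t<n * h. f t) = (\<Sum>r<n. \<Sum>p<h. f (p * n + r))"
proof -
  have "(\<Sum>t<n * h. f t) = (\<Sum>p<h. \<Sum>r<n. f (p * n + r))"
  proof (induction h)
    case (Suc h)
    have "n * Suc h = n * h + n" by simp
    then have "(\<Sum>t<n * Suc h. f t) = (\<Sum>t<n * h. f t) + (\<Sum>r<n. f (n * h + r))"
      by (simp only: sum_lessThan_add)
    then show ?case using Suc by (simp only: sum.lessThan_Suc mult.commute[of n h])
  qed simp
  then show ?thesis by (simp only: sum.swap[of _ "{..<n}"])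
qed

lemma bij_betw_double_mod:
  fixes n :: nat
  assumes "odd n"
  shows "bij_betw (\<lambda>r. (2 * r + a) mod n) {..<n} {..<n}"
proof (rule bij_betw_of_inj)
  have *: False if "r < r'" "r' < n" "(2 * r + a) mod n = (2 * r' + a) mod n" for r r'
  proof -
    have "n dvd (2 * r' + a) - (2 * r + a)"
      using that by (subst mod_eq_dvd_iff_nat[symmetric]) auto
    then have "n dvd 2 * (r' - r)" by (simp add: diff_mult_distrib2)
    then have "n dvd r' - r" using assms by (simp add: coprime_dvd_mult_right_iff)
    then show False using that by (auto dest: dvd_imp_le)
  qed
  show "inj_on (\<lambda>r. (2 * r + a) mod n) {..<n}"
  proof (rule inj_onI)
    fix r r' assume "r \<in> {..<n}" "r' \<in> {..<n}" "(2 * r + a) mod n = (2 * r' + a) mod n"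
    then show "r = r'" using *[of r r'] *[of r' r] by (cases r r' rule: linorder_cases) auto
  qed
qed (use assms in \<open>auto simp: odd_pos\<close>)

text \<open>The value \<open>(2 * t + a) mod n\<close> depends only on \<open>t\<close> modulo
  \<open>n\<close>, and doubling is a bijection modulo an odd \<open>n\<close>. So exactly one
  residue class contributes at \<open>v\<close>. Weights 1 give the degrees, the weights
  \<open>W\<close> the flow.\<close>

lemma sum_double_mod:
  fixes n h :: nat and W :: "nat \<Rightarrow> 'a::comm_semiring_1"
  assumes n: "odd n" and W: "\<And>r. r < n \<Longrightarrow> (\<Sum>p<h. W (p * n + r)) = C" and v: "v < n"
  shows "(\<Sum>t<n * h. W t * of_bool ((2 * t + a) mod n = v)) = C"
proof -
  have m: "(2 * (p * n + r) + a) mod n = (2 * r + a) mod n" for p r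
  proof -
    have "2 * (p * n + r) + a = (2 * r + a) + (2 * p) * n" by (simp add: algebra_simps)
    then show ?thesis by (simp only: mod_mult_self1)
  qed
  have "(\<Sum>t<n * h. W t * of_bool ((2 * t + a) mod n = v))
      = (\<Sum>r<n. (\<Sum>p<h. W (p * n + r)) * of_bool ((2 * r + a) mod n = v))"
    unfolding sum_regroup m sum_distrib_right ..
  also have "\<dots> = (\<Sum>r<n. C * of_bool ((2 * r + a) mod n = v))"
    by (rule sum.cong) (use W in auto)
  also have "\<dots> = (\<Sum>u<n. C * of_bool (u = v))"
    by (rule sum.reindex_bij_betw[OF bij_betw_double_mod[OF n]])
  also have "\<dots> = C" using v by (simp add: of_bool_def if_distrib cong: if_cong)
  finally show ?thesis .
qed

text \<open>Edge t joins 2t and 2t + 1 modulo n, so fewer than n/2 consecutive edges are pairwise disjoint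
  and colouring the edges in consecutive blocks of length q is proper. Any n consecutive edges form
  an n-cycle, which is why the weights only need constant sums over each residue class.\<close>

lemma int_array_odd_columns:
  assumes n: "odd n" and h: "h \<noteq> 1" and N: "m * q = n * h" and q: "0 < q" "2 * q \<le> n"
  shows "\<exists>B. int_array m n (2 * q) (2 * h) B"
proof -
  obtain W C where W: "const_weights n h W C" using const_weights_ex[OF n h] by blast
  \<comment> \<open>The inequality is strict because \<open>n\<close> is odd.\<close>
  have q2: "2 * q < n" using q n by (metis dvd_triv_left le_neq_implies_less)
  have meet: "(2 * t + a) mod n \<noteq> (2 * t' + b) mod n"
    if "2 * t + a < 2 * t' + b" "2 * t' + b < 2 * t + a + n" for t t' a b
  proof
    assume "(2 * t + a) mod n = (2 * t' + b) mod n"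
    then have "n dvd (2 * t' + b) - (2 * t + a)"
      using that by (subst mod_eq_dvd_iff_nat[symmetric]) auto
    then show False using that by (auto dest!: dvd_imp_le)
  qed
  \<comment> \<open>The unreduced endpoints of the two edges differ by at least 1 and at most
    \<open>2 * q - 1\<close>, which is less than \<open>n\<close>. The form \<open>+ 0\<close> makes
    both endpoints instances of one expression in \<open>a\<close>.\<close>
  have apart: "{(2 * t + 0) mod n, (2 * t + 1) mod n} \<inter> {(2 * t' + 0) mod n, (2 * t' + 1) mod n} = {}"
    if "t < t'" "t' < t + q" for t t'
    using meet[of t 0 t' 0] meet[of t 0 t' 1] meet[of t 1 t' 0] meet[of t 1 t' 1] that q2 by auto
  have close: "t' < t + q" if "t div q = t' div q" for t t'
  proof -
    have "t' = t div q * q + t' mod q" unfolding that by simp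
    also have "\<dots> < t div q * q + q" using q(1) by (intro add_strict_left_mono mod_less_divisor)
    also have "\<dots> \<le> t + q" by simp
    finally show ?thesis .
  qed
  have ne: "(2 * t + 0) mod n \<noteq> (2 * t + 1) mod n" for t
    using meet[of t 0 t 1] q q2 by simp
  show ?thesis
  proof (rule int_array_of_graph[where N = "n * h" and src = "\<lambda>t. (2 * t + 0) mod n"
        and tgt = "\<lambda>t. (2 * t + 1) mod n" and col = "\<lambda>t. t div q" and w = W])
    show "proper_col (\<lambda>t. {(2 * t + 0) mod n, (2 * t + 1) mod n}) {..<n * h} m (\<lambda>t. t div q)"
      unfolding proper_col_def
    proof (intro conjI ballI impI)
      fix t assume "t \<in> {..<n * h}"
      then show "t div q < m" using N by (simp add: less_mult_imp_div_less)
    next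
      fix t t' assume "t \<noteq> t'" "t div q = t' div q"
      then show "{(2 * t + 0) mod n, (2 * t + 1) mod n} \<inter> {(2 * t' + 0) mod n, (2 * t' + 1) mod n} = {}"
        using apart[of t t'] apart[of t' t] close[of t t'] close[of t' t]
        by (cases t t' rule: linorder_cases) (auto simp: Int_commute)
    qed
    show "bij_betw (\<lambda>t. \<bar>W t\<bar>) {..<n * h} {1..int (n * h)}"
      using W by (simp add: const_weights_def)
    fix v assume v: "v < n"
    have one: "(\<Sum>t<n * h. of_bool ((2 * t + a) mod n = v)) = h" for a
      using sum_double_mod[OF n _ v, where h = h and W = "\<lambda>_. 1" and C = h and a = a] by simp
    show "card {t. t < n * h \<and> v \<in> {(2 * t + 0) mod n, (2 * t + 1) mod n}} = 2 * h"
      unfolding card_incident[OF ne] one by simp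
    have "(\<Sum>t<n * h. W t * of_bool ((2 * t + a) mod n = v)) = C" for a
      by (rule sum_double_mod[OF n _ v]) (use W in \<open>simp add: const_weights_def\<close>)
    then show "(\<Sum>t<n * h. W t * of_bool ((2 * t + 0) mod n = v))
        = (\<Sum>t<n * h. W t * of_bool ((2 * t + 1) mod n = v))"
      by (simp only:)
  qed (use N ne n in \<open>auto simp: odd_pos\<close>)
qed

subsection \<open>Characterisation\<close>

lemma int_array_ex:
  assumes "even s" "even k" "0 < s" "4 \<le> k" "m * s = n * k" "s \<le> n" "n = 2 \<longrightarrow> k mod 4 = 0"
  shows "\<exists>B. int_array m n s k B"
proof -
  obtain q h where qh: "s = 2 * q" "k = 2 * h" using assms(1,2) by (auto elim!: evenE)
  have N: "m * q = n * h" using assms(5) by (simp add: qh)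
  \<comment> \<open>This yields \<open>k \<le> m\<close>, so that the \<open>k\<close> colours of
    the even construction fit into \<open>m\<close> rows.\<close>
  have "n * k \<le> n * m" using assms(5,6) by (metis mult_le_mono2 mult.commute)
  then have "k \<le> m" using assms(3,6) by simp
  show ?thesis
  proof (cases "even n")
    case True
    have "even h" if "n = 2" using assms(7) that qh(2) by presburger
    then have "flow_graph_ex n h" using True assms qh by (intro flow_graph_ex_even) auto
    then show ?thesis using int_array_even_columns[OF _ N] \<open>k \<le> m\<close> qh by simp
  next
    case False
    then show ?thesis using int_array_odd_columns[of n h m q] N assms qh by auto
  qed
qed

theorem theorem4:
  fixes m n s k :: nat
  assumes "0 < m" "0 < n" "0 < s" "0 < k" "even s" "even k"
  shows "(\<exists>A. integer_heffter 2 1 m n s k A) \<longleftrightarrow>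
         (m * s = n * k \<and> 2 \<le> s \<and> s \<le> n \<and> 2 \<le> k \<and> k \<le> m
          \<and> (s = 2 \<longrightarrow> ((n = 2 \<and> m = k \<and> k mod 4 = 0) \<or> (n \<ge> 3 \<and> k \<ge> 3)))
          \<and> (k = 2 \<longrightarrow> ((m = 2 \<and> n = s \<and> s mod 4 = 0) \<or> (m \<ge> 3 \<and> s \<ge> 3))))"
  unfolding ex_integer_heffter_iff[OF assms(6)]
proof
  assume "\<exists>B. int_array m n s k B"
  then obtain B where B: "int_array m n s k B" by blast
  then have ms: "m * s = n * k" using filled_card[of m n B s k] by (auto simp: int_array_def)
  have s2: "2 \<le> s" and k2: "2 \<le> k" using assms by presburger+
  have "card {j. j < n \<and> B 0 j \<noteq> 0} = s" using B assms(1) by (auto simp: int_array_def)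
  moreover have "card {j. j < n \<and> B 0 j \<noteq> 0} \<le> card {..<n}" by (rule card_mono) auto
  ultimately have sn: "s \<le> n" by simp
  have "card {i. i < m \<and> B i 0 \<noteq> 0} = k" using B assms(2) by (auto simp: int_array_def)
  moreover have "card {i. i < m \<and> B i 0 \<noteq> 0} \<le> card {..<m}" by (rule card_mono) auto
  ultimately have km: "k \<le> m" by simp
  have not22: "\<not> (s = 2 \<and> k = 2)" using int_array_2_2_False B assms(2) by blast
  have 1: "k mod 4 = 0" if "s = 2" "n = 2" using int_array_two_columns B that assms(6) by blast
  have 2: "s mod 4 = 0" if "k = 2" "m = 2"
    using int_array_two_columns int_array_transpose[OF B] that assms(5) by blast
  have 3: "m = k" if "s = 2" "n = 2" using ms that by simp
  have 4: "n = s" if "k = 2" "m = 2" using ms that by simp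
  show "m * s = n * k \<and> 2 \<le> s \<and> s \<le> n \<and> 2 \<le> k \<and> k \<le> m
          \<and> (s = 2 \<longrightarrow> ((n = 2 \<and> m = k \<and> k mod 4 = 0) \<or> (n \<ge> 3 \<and> k \<ge> 3)))
          \<and> (k = 2 \<longrightarrow> ((m = 2 \<and> n = s \<and> s mod 4 = 0) \<or> (m \<ge> 3 \<and> s \<ge> 3)))"
    using ms s2 k2 sn km not22 1 2 3 4 by auto
next
  assume R: "m * s = n * k \<and> 2 \<le> s \<and> s \<le> n \<and> 2 \<le> k \<and> k \<le> m
          \<and> (s = 2 \<longrightarrow> ((n = 2 \<and> m = k \<and> k mod 4 = 0) \<or> (n \<ge> 3 \<and> k \<ge> 3)))
          \<and> (k = 2 \<longrightarrow> ((m = 2 \<and> n = s \<and> s mod 4 = 0) \<or> (m \<ge> 3 \<and> s \<ge> 3)))"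
  show "\<exists>B. int_array m n s k B"
  proof (cases "k = 2")
    case False
    \<comment> \<open>If \<open>n = 2\<close>, then \<open>s \<le> n\<close> forces
      \<open>s = 2\<close>, and the first condition supplies the divisibility of \<open>k\<close> by
      4.\<close>
    then have "4 \<le> k" using R assms(6) by presburger
    then show ?thesis using R assms by (intro int_array_ex) auto
  next
    case True
    \<comment> \<open>With \<open>k = 2\<close> and \<open>s = 2\<close> the first condition fails
      unless \<open>n = 2\<close> and 4 divides \<open>k\<close>, or \<open>k \<ge> 3\<close>; both
      are impossible. So \<open>s\<close> takes the role of \<open>k\<close> in the transposed
      array.\<close>
    then have "s \<noteq> 2" using R by auto
    then have "4 \<le> s" using R assms(5) by presburger
    then have "\<exists>B. int_array n m k s B" using R assms True by (intro int_array_ex) auto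
    then show ?thesis using int_array_transpose by blast
  qed
qed

end
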